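(* There exists a constant $C>0$ (depending only on $\phi$ and $d$) such that $$p^{\phi}(n,x,y)\ge C\left(\big(\phi^{-1}(n^{-1})\big)^{d/2}\wedge\frac{n}{|x-y|^d}\,\phi(|x-y|^{-2})\right)$$ for all $x,y\in\mathbb{Z}^d$ and all $n\in\mathbb{N}=\{1,2,\dots\}$.
   Context: Let $d\ge 1$ and let $(S_n)_{n\ge0}$ be the simple symmetric random walk on $\mathbb{Z}^d$ (each step is uniform on $\{\pm e_1,\dots,\pm e_d\}$). Let $\phi$ be a complete Bernstein function without drift, normalized by $\phi(0)=0$, $\phi(1)=1$; i.e. $\phi(\lambda)=\int_{(0,\infty)}(1-e^{-\lambda t})\,\mu(dt)$, where $\mu$ is a measure with $\int_{(0,\infty)}(1\wedge t)\,\mu(dt)<\infty$ having a completely monotone density with respect to Lebesgue measure. Assume the scaling condition: there are constants $c_*,c^*>0$ and $0<\alpha_*\le\alpha^*<1$ with $$c_*\Big(\frac Rr\Big)^{\alpha_*}\le\frac{\phi(R)}{\phi(r)}\le c^*\Big(\frac Rr\Big)^{\alpha^*},\qquad 0<r\le R\le1 .$$ The function $\phi$ is strictly increasing and $\phi^{-1}$ denotes its inverse (well defined on $(0,1]$). Put $a_m^\phi=\frac1{m!}\int_{(0,\infty)}t^me^{-t}\,\mu(dt)$, $m\ge1$; then $\sum_{m\ge1}a_m^\phi=1$. Let $R_1,R_2,\dots$ be i.i.d., independent of $(S_n)$, with $\mathbb{P}(R_1=m)=a_m^\phi$, and $\tau_n=R_1+\cdots+R_n$. The subordinate random walk is $S^\phi_n=S_{\tau_n}$,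 $n\ge0$. $\mathbb{P}^x$ is the law of the walk started at $x$ and $p^\phi(n,x,y)=\mathbb{P}^x(S^\phi_n=y)$. Notation: $a\wedge b=\min\{a,b\}$, $|\cdot|$ is the Euclidean norm; for $x=y$ the expression $\frac{n}{|x-y|^d}\phi(|x-y|^{-2})$ is interpreted as $+\infty$. *)

theory Defs
  imports "HOL-Probability.Probability"
begin

text \<open>Complete monotonicity on the open half-line; the values of \<open>f\<close> outside it are irrelevant.\<close>

definition completely_monotone :: "(real \<Rightarrow> real) \<Rightarrow> bool" where
  "completely_monotone f \<longleftrightarrow>
     (\<forall>k. \<forall>t>0. (deriv ^^ k) f field_differentiable (at t) \<and> (-1) ^ k * (deriv ^^ k) f t \<ge> 0)"

text \<open>A measure on the open half-line is represented as a Borel measure on the reals which is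
  null outside it; this is enforced by the indicator in the density.\<close>

definition complete_bernstein :: "(real \<Rightarrow> real) \<Rightarrow> real measure \<Rightarrow> bool" where
  "complete_bernstein \<phi> \<mu> \<longleftrightarrow>
     (\<exists>f. completely_monotone f \<and>
          \<mu> = density lborel (\<lambda>t. ennreal (indicator {0<..} t * f t))) \<and>
     (\<integral>\<^sup>+t\<in>{0<..}. ennreal (min 1 t) \<partial>\<mu>) < \<infinity> \<and>
     (\<forall>l\<ge>0. \<phi> l = (LINT t:{0<..}|\<mu>. 1 - exp (- l * t)))"

definition scaling_condition :: "(real \<Rightarrow> real) \<Rightarrow> bool" where
  "scaling_condition \<phi> \<longleftrightarrow>
     (\<exists>c1 c2 \<alpha>1 \<alpha>2. c1 > 0 \<and> c2 > 0 \<and> 0 < \<alpha>1 \<and> \<alpha>1 \<le> \<alpha>2 \<and> \<alpha>2 < 1 \<and>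
        (\<forall>r R. 0 < r \<and> r \<le> R \<and> R \<le> 1 \<longrightarrow>
           c1 * (R / r) powr \<alpha>1 \<le> \<phi> R / \<phi> r \<and> \<phi> R / \<phi> r \<le> c2 * (R / r) powr \<alpha>2))"

definition bernstein_coeff :: "real measure \<Rightarrow> nat \<Rightarrow> real" where
  "bernstein_coeff \<mu> m = 1 / fact m * (LINT t:{0<..}|\<mu>. t ^ m * exp (- t))"

text \<open>The law of the increments \<open>R\<^sub>i\<close>, supported on the positive integers. Lemma \<open>pmf_increment\<close>
  below shows that these weights really define a probability mass function.\<close>

definition increment_pmf :: "real measure \<Rightarrow> nat pmf" where
  "increment_pmf \<mu> = embed_pmf (\<lambda>m. if m = 0 then 0 else bernstein_coeff \<mu> m)"

definition step_pmf :: "(int ^ 'd::finite) pmf" where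
  "step_pmf = pmf_of_set (range (\<lambda>i. axis i 1) \<union> range (\<lambda>i. - axis i 1))"

text \<open>Canonical probability space: a point \<open>(\<xi>, \<rho>)\<close> consists of the sequence of steps of the
  simple random walk and the sequence of increments of the subordinator. The product measure makes
  all of these independent. Index \<open>i\<close> stands for the step (increment) number \<open>i + 1\<close>.\<close>

definition walk_space :: "real measure \<Rightarrow> ((nat \<Rightarrow> int ^ 'd::finite) \<times> (nat \<Rightarrow> nat)) measure" where
  "walk_space \<mu> =
     PiM UNIV (\<lambda>_. measure_pmf step_pmf) \<Otimes>\<^sub>M PiM UNIV (\<lambda>_. measure_pmf (increment_pmf \<mu>))"

definition simple_walk :: "int ^ 'd::finite \<Rightarrow> (nat \<Rightarrow> int ^ 'd) \<Rightarrow> nat \<Rightarrow> int ^ 'd" where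
  "simple_walk x \<xi> n = x + (\<Sum>i<n. \<xi> i)"

definition subordinator :: "(nat \<Rightarrow> nat) \<Rightarrow> nat \<Rightarrow> nat" where
  "subordinator \<rho> n = (\<Sum>i<n. \<rho> i)"

definition subordinate_walk ::
    "int ^ 'd::finite \<Rightarrow> (nat \<Rightarrow> int ^ 'd) \<times> (nat \<Rightarrow> nat) \<Rightarrow> nat \<Rightarrow> int ^ 'd" where
  "subordinate_walk x \<omega> n = simple_walk x (fst \<omega>) (subordinator (snd \<omega>) n)"

definition transition_prob :: "real measure \<Rightarrow> nat \<Rightarrow> int ^ 'd::finite \<Rightarrow> int ^ 'd \<Rightarrow> real" where
  "transition_prob \<mu> n x y =
     measure (walk_space \<mu>) {\<omega> \<in> space (walk_space \<mu>). subordinate_walk x \<omega> n = y}"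

definition lattice_norm :: "int ^ 'd::finite \<Rightarrow> real" where
  "lattice_norm z = norm (\<chi> i. real_of_int (z $ i))"

lemma pmf_increment:
  assumes "complete_bernstein \<phi> \<mu>" "\<phi> 1 = 1"
  shows "pmf (increment_pmf \<mu>) m = (if m = 0 then 0 else bernstein_coeff \<mu> m)"
proof -
  define w where "w = (\<lambda>m. if m = 0 then 0 else bernstein_coeff \<mu> m)"
  define g where "g = (\<lambda>m t::real. if m = 0 then 0 else indicator {0<..} t * (t ^ m * exp (- t) / fact m))"
  obtain f where mu: "\<mu> = density lborel (\<lambda>t. ennreal (indicator {0<..} t * f t))"
    and fin: "(\<integral>\<^sup>+t\<in>{0<..}. ennreal (min 1 t) \<partial>\<mu>) < \<infinity>"
    and one: "(LINT t:{0<..}|\<mu>. 1 - exp (- t)) = 1"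
    using assms unfolding complete_bernstein_def by force
  have sets_mu [measurable_cong]: "sets \<mu> = sets borel" by (simp add: mu)
  have g_meas [measurable]: "g m \<in> borel_measurable \<mu>" for m
    unfolding g_def by measurable
  have g_nonneg: "g m t \<ge> 0" for m t
    by (auto simp: g_def indicator_def)
  have w_nonneg: "w m \<ge> 0" for m
    unfolding w_def bernstein_coeff_def set_lebesgue_integral_def
    by (auto intro!: Bochner_Integration.integral_nonneg simp: indicator_def)
  have g_sums: "(\<lambda>m. g m t) sums (indicator {0<..} t * (1 - exp (- t)))" for t :: real
  proof (cases "t > 0")
    case True
    have "(\<lambda>m. t ^ m / fact m) sums exp t"
      using exp_converges[of t] by (simp add: divide_inverse mult.commute)
    hence "(\<lambda>m. t ^ Suc m / fact (Suc m)) sums (exp t - 1)"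
      by (subst sums_Suc_iff) simp
    hence "(\<lambda>m. (t ^ Suc m / fact (Suc m)) * exp (- t)) sums ((exp t - 1) * exp (- t))"
      by (rule sums_mult2)
    moreover have "(exp t - 1) * exp (- t) = 1 - exp (- t)"
      by (simp add: left_diff_distrib flip: exp_add)
    ultimately have "(\<lambda>m. g (Suc m) t) sums (1 - exp (- t))"
      using True by (simp add: g_def)
    hence "(\<lambda>m. g m t) sums (1 - exp (- t) + g 0 t)"
      by (subst (asm) sums_Suc_iff) (simp add: g_def)
    thus ?thesis using True by (simp add: g_def)
  next
    case False
    hence "(\<lambda>m. g m t) = (\<lambda>_. 0)" by (auto simp: g_def)
    thus ?thesis using False by simp
  qed
  have le: "1 - exp (- t) \<le> min 1 t" for t :: real
    using exp_ge_add_one_self[of "- t"] by simp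
  have tot_int: "integrable \<mu> (\<lambda>t. indicator {0<..} t * (1 - exp (- t)))"
  proof (rule integrableI_nonneg)
    have "(\<integral>\<^sup>+t. ennreal (indicator {0<..} t * (1 - exp (- t))) \<partial>\<mu>)
        \<le> (\<integral>\<^sup>+t\<in>{0<..}. ennreal (min 1 t) \<partial>\<mu>)"
      using le by (intro nn_integral_mono) (auto simp: indicator_def intro!: ennreal_leI)
    thus "(\<integral>\<^sup>+t. ennreal (indicator {0<..} t * (1 - exp (- t))) \<partial>\<mu>) < \<infinity>"
      using fin by (rule le_less_trans)
  qed (auto simp: indicator_def)
  have g_le: "g m t \<le> indicator {0<..} t * (1 - exp (- t))" for m t
    using sum_le_suminf[OF sums_summable[OF g_sums], of "{m}" t] g_nonneg
      sums_unique[OF g_sums, of t] by auto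
  have g_int: "integrable \<mu> (g m)" for m
    by (rule Bochner_Integration.integrable_bound[OF tot_int])
       (use g_nonneg g_le in \<open>auto intro!: AE_I2 simp: order.trans[OF g_le abs_ge_self]\<close>)
  have w_eq: "ennreal (w m) = (\<integral>\<^sup>+t. ennreal (g m t) \<partial>\<mu>)" for m
  proof -
    have "w m = integral\<^sup>L \<mu> (g m)"
    proof (cases "m = 0")
      case False
      have "g m = (\<lambda>t. 1 / fact m * (indicator {0<..} t *\<^sub>R (t ^ m * exp (- t))))"
        using False by (simp add: g_def fun_eq_iff)
      thus ?thesis using False
        by (simp add: w_def bernstein_coeff_def set_lebesgue_integral_def del: times_divide_eq_left)
    qed (simp add: w_def g_def)
    thus ?thesis using nn_integral_eq_integral[OF g_int] g_nonneg by simp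
  qed
  have "(\<integral>\<^sup>+m. ennreal (w m) \<partial>count_space UNIV) = (\<Sum>m. \<integral>\<^sup>+t. ennreal (g m t) \<partial>\<mu>)"
    by (simp add: nn_integral_count_space_nat w_eq)
  also have "\<dots> = (\<integral>\<^sup>+t. (\<Sum>m. ennreal (g m t)) \<partial>\<mu>)"
    by (rule nn_integral_suminf[symmetric]) simp
  also have "\<dots> = (\<integral>\<^sup>+t. ennreal (indicator {0<..} t * (1 - exp (- t))) \<partial>\<mu>)"
    using g_sums g_nonneg by (intro nn_integral_cong suminf_ennreal_eq) auto
  also have "\<dots> = ennreal (LINT t|\<mu>. indicator {0<..} t * (1 - exp (- t)))"
    by (rule nn_integral_eq_integral[OF tot_int]) (auto simp: indicator_def)
  also have "\<dots> = 1"
    using one by (simp add: set_lebesgue_integral_def)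
  finally have "(\<integral>\<^sup>+m. ennreal (w m) \<partial>count_space UNIV) = 1" .
  thus ?thesis
    using w_nonneg unfolding increment_pmf_def w_def[symmetric]
    by (subst pmf_embed_pmf) (auto simp: w_def)
qed

end

theory Submission
  imports Defs
begin

text \<open>
  Conditioning on the clock gives
  \<open>p(n, x, y) \<ge> \<Sum>m\<in>I. P(\<tau>\<^sub>n = m) \<cdot> P(S\<^sub>m = y - x)\<close> for every finite set \<open>I\<close> of times
  (\<open>transition_prob_ge_sum\<close>). Put \<open>r = max(|x - y|\<^sup>2, 1 / \<phi>\<^sup>-\<^sup>1(1 / n))\<close>. Then
  \<open>n \<phi>(1 / r) \<le> 1\<close>, and both branches of the minimum in the theorem are the single quantity
  \<open>n \<phi>(1 / r) r\<^sup>-\<^sup>d\<^sup>/\<^sup>2\<close>. So it is enough to find a block of times of length and size comparable to \<open>r\<close>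
  on which \<open>P(\<tau>\<^sub>n = m)\<close> is at least of order \<open>n \<phi>(1 / r) / r\<close>, uniformly in \<open>m\<close>, and
  on which the sum of \<open>P(S\<^sub>m = y - x)\<close> is at least of order \<open>r \<cdot> r\<^sup>-\<^sup>d\<^sup>/\<^sup>2\<close>
  (\<open>transition_prob_scale_lower_bound\<close>). Because the clock bound is uniform in \<open>m\<close>, the parity
  constraint of the walk is harmless: it is averaged out over the block.

  The clock. The density of \<open>\<mu>\<close> is decreasing, hence so are the weights of the increment law
  (\<open>increment_pmf_decreasing\<close>). Its generating function is \<open>1 - \<phi>(1 - z)\<close>, so the truncated
  means \<open>E[min 1 (R / N)]\<close> are comparable to \<open>\<phi>(1 / N)\<close>. Comparing them at three scales,
  the scaling condition shows that a fixed part of \<open>\<phi>(1 / N)\<close> is carried by values comparable to \<open>N\<close>, and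
  monotonicity turns this into \<open>P(R = N) \<ge> c \<phi>(1 / N) / N\<close>
  (\<open>increment_pmf_lower_bound\<close>). The event that \<open>\<tau>\<^sub>n = m\<close> is produced by exactly one large
  increment, while the remaining increments have a sum at most \<open>s < m / 2\<close>, then gives the required
  bound for \<open>P(\<tau>\<^sub>n = m)\<close> (\<open>convolution_power_one_big_jump\<close>,
  \<open>subordinator_pmf_lower_bound\<close>).

  The walk. Second and fourth moments show that after a time of order \<open>k\<close> the walk lies with
  probability bounded below in a box of side of order \<open>\<surd>k\<close> that is well inside the
  positive orthant (\<open>walk_spread_all_coordinates\<close>). Along each coordinate axis and within a
  parity class, the law of the walk is decreasing away from the origin (\<open>pmf_walk_unimodal\<close>). So
  any point \<open>z\<close> that is closer to the origin than the box is at least as likely as every point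
  of the box, up to at most \<open>d\<close> extra steps that adjust the parities, and since the box has only
  about \<open>k\<^sup>d\<^sup>/\<^sup>2\<close> points, \<open>z\<close> has probability of order at least \<open>k\<^sup>-\<^sup>d\<^sup>/\<^sup>2\<close>
  (\<open>walk_local_lower_bound\<close>).
\<close>

section \<open>Bernstein functions and the increment weights\<close>

lemma complete_bernstein_decreasing_density:
  assumes "complete_bernstein \<phi> \<mu>"
  obtains f where "\<mu> = density lborel (\<lambda>t. ennreal (indicator {0<..} t * f t))"
    and "(\<lambda>t. indicator {0<..} t * f t) \<in> borel_measurable borel"
    and "\<And>t. t > 0 \<Longrightarrow> f t \<ge> 0"
    and "\<And>s t. 0 < s \<Longrightarrow> s \<le> t \<Longrightarrow> f t \<le> f s"
proof -
  obtain f where f: "completely_monotone f"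
    and mu: "\<mu> = density lborel (\<lambda>t. ennreal (indicator {0<..} t * f t))"
    using assms unfolding complete_bernstein_def by blast
  have diff: "f field_differentiable (at t)" and nonneg: "f t \<ge> 0" if "t > 0" for t
    using f[unfolded completely_monotone_def, rule_format, of t 0] that by auto
  have deriv: "deriv f t \<le> 0" if "t > 0" for t
    using f[unfolded completely_monotone_def, rule_format, of t 1] that by auto
  have decr: "f t \<le> f s" if "0 < s" "s \<le> t" for s t
  proof (rule DERIV_nonpos_imp_nonincreasing[OF \<open>s \<le> t\<close>])
    fix x assume "s \<le> x" "x \<le> t"
    thus "\<exists>y. DERIV f x :> y \<and> y \<le> 0"
      using diff[of x] deriv[of x] \<open>0 < s\<close> by (intro exI[of _ "deriv f x"])
        (auto simp: DERIV_deriv_iff_field_differentiable)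
  qed
  have "continuous_on {0<..} f"
    using diff by (intro continuous_at_imp_continuous_on) (auto simp: field_differentiable_imp_continuous_at)
  hence "(\<lambda>t. indicator {0<..} t *\<^sub>R f t) \<in> borel_measurable borel"
    by (intro borel_measurable_continuous_on_indicator) auto
  thus ?thesis using that[OF mu _ nonneg decr] by auto
qed

text \<open>The bound \<open>1 - exp (- l t) \<le> max 1 l \<cdot> min 1 t\<close> reduces integrability to the integrability
of \<open>min 1 t\<close> that is part of the definition.\<close>

lemma complete_bernstein_integrable:
  assumes "complete_bernstein \<phi> \<mu>" and "l \<ge> 0"
  shows "integrable \<mu> (\<lambda>t. indicator {0<..} t * (1 - exp (- l * t)))"
    and "\<phi> l = (LINT t|\<mu>. indicator {0<..} t * (1 - exp (- l * t)))"
proof -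
  obtain f where mu: "\<mu> = density lborel (\<lambda>t. ennreal (indicator {0<..} t * f t))"
    using complete_bernstein_decreasing_density[OF assms(1)] by blast
  have sets_mu [measurable_cong]: "sets \<mu> = sets borel" by (simp add: mu)
  have fin: "(\<integral>\<^sup>+t\<in>{0<..}. ennreal (min 1 t) \<partial>\<mu>) < \<infinity>"
    and phi: "\<phi> l = (LINT t:{0<..}|\<mu>. 1 - exp (- l * t))"
    using assms unfolding complete_bernstein_def by auto
  have "integrable \<mu> (\<lambda>t. indicator {0<..} t * min 1 t)"
  proof (rule integrableI_nonneg)
    have "(\<integral>\<^sup>+t. ennreal (indicator {0<..} t * min 1 t) \<partial>\<mu>) = (\<integral>\<^sup>+t\<in>{0<..}. ennreal (min 1 t) \<partial>\<mu>)"
      by (intro nn_integral_cong) (auto simp: indicator_def)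
    thus "(\<integral>\<^sup>+t. ennreal (indicator {0<..} t * min 1 t) \<partial>\<mu>) < \<infinity>" using fin by simp
  qed (auto simp: indicator_def)
  hence "integrable \<mu> (\<lambda>t. max 1 l * (indicator {0<..} t * min 1 t))"
    by (rule integrable_mult_right)
  thus "integrable \<mu> (\<lambda>t. indicator {0<..} t * (1 - exp (- l * t)))"
  proof (rule Bochner_Integration.integrable_bound)
    have "1 - exp (- l * t) \<le> max 1 l * min 1 t" if "t > 0" for t
    proof (cases "t \<le> 1")
      case True
      have "1 - exp (- l * t) \<le> l * t"
        using exp_ge_add_one_self[of "- l * t"] by simp
      also have "\<dots> \<le> max 1 l * t" using that by (intro mult_right_mono) auto
      finally show ?thesis using True by (simp add: min_def)
    next
      case False
      have "1 - exp (- l * t) \<le> 1" by simp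
      also have "\<dots> \<le> max 1 l" by simp
      finally show ?thesis using False by (simp add: min_def)
    qed
    thus "AE t in \<mu>. norm (indicator {0<..} t * (1 - exp (- l * t)))
        \<le> norm (max 1 l * (indicator {0<..} t * min 1 t))"
      using \<open>l \<ge> 0\<close> by (intro AE_I2) (auto simp: indicator_def abs_mult max_def)
  qed simp
  show "\<phi> l = (LINT t|\<mu>. indicator {0<..} t * (1 - exp (- l * t)))"
    using phi by (simp add: set_lebesgue_integral_def)
qed

lemma complete_bernstein_nonneg:
  assumes "complete_bernstein \<phi> \<mu>" and "l \<ge> 0"
  shows "\<phi> l \<ge> 0"
  unfolding complete_bernstein_integrable(2)[OF assms]
  using assms(2) by (intro Bochner_Integration.integral_nonneg) (auto simp: indicator_def)

text \<open>If two values agreed, the nonnegative integrand of their difference would vanish almost everywhere,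
so \<open>\<mu>\<close> would have no mass on the half-line, contradicting \<open>\<phi> 1 = 1\<close>.\<close>

lemma complete_bernstein_strict_mono:
  assumes "complete_bernstein \<phi> \<mu>" and "\<phi> 1 = 1"
  shows "strict_mono_on {0..} \<phi>"
proof (rule strict_mono_onI)
  fix k l :: real assume "k \<in> {0..}" "l \<in> {0..}" "k < l"
  hence kl: "0 \<le> k" "k < l" "0 \<le> l" by auto
  let ?h = "\<lambda>t. indicator {0<..} t * (1 - exp (- l * t)) - indicator {0<..} t * (1 - exp (- k * t))"
  have eq: "\<phi> l - \<phi> k = integral\<^sup>L \<mu> ?h"
    using complete_bernstein_integrable[OF assms(1)] kl by simp
  have nonneg: "?h t \<ge> 0" for t
    using kl by (auto simp: indicator_def mult_right_mono)
  have "integral\<^sup>L \<mu> ?h \<noteq> 0"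
  proof
    assume "integral\<^sup>L \<mu> ?h = 0"
    hence "AE t in \<mu>. ?h t = 0"
      using integral_nonneg_eq_0_iff_AE[of \<mu> ?h] complete_bernstein_integrable[OF assms(1)] kl nonneg
      by (auto intro!: Bochner_Integration.integrable_diff)
    hence "AE t in \<mu>. indicator {0<..} t * (1 - exp (- 1 * t)) = 0"
      by eventually_elim (use kl in \<open>auto simp: indicator_def\<close>)
    hence "(LINT t|\<mu>. indicator {0<..} t * (1 - exp (- 1 * t))) = 0"
      by (rule integral_eq_zero_AE)
    thus False
      using complete_bernstein_integrable(2)[OF assms(1), of 1] assms(2) by simp
  qed
  moreover have "integral\<^sup>L \<mu> ?h \<ge> 0" using nonneg by (intro Bochner_Integration.integral_nonneg)
  ultimately show "\<phi> k < \<phi> l" using eq by linarith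
qed

text \<open>Subadditivity, from \<open>exp (- l t) (1 - exp (- h t)) \<le> 1 - exp (- h t)\<close> under the integral. It
reduces continuity of \<open>\<phi>\<close> everywhere to continuity at the origin.\<close>

lemma complete_bernstein_increment_le:
  assumes "complete_bernstein \<phi> \<mu>" and "l \<ge> 0" "h \<ge> 0"
  shows "\<phi> (l + h) - \<phi> l \<le> \<phi> h"
proof -
  have "\<phi> (l + h) - \<phi> l = (LINT t|\<mu>. indicator {0<..} t * (1 - exp (- (l + h) * t))
      - indicator {0<..} t * (1 - exp (- l * t)))"
    using complete_bernstein_integrable[OF assms(1), of l] complete_bernstein_integrable[OF assms(1), of "l + h"]
      assms(2,3) by (subst Bochner_Integration.integral_diff) auto
  also have "\<dots> \<le> (LINT t|\<mu>. indicator {0<..} t * (1 - exp (- h * t)))"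
  proof (rule integral_mono)
    fix t :: real
    have "exp (- l * t) * (1 - exp (- h * t)) \<le> 1 * (1 - exp (- h * t))" if "t > 0"
      using that assms by (intro mult_right_mono) auto
    thus "indicator {0<..} t * (1 - exp (- (l + h) * t)) - indicator {0<..} t * (1 - exp (- l * t))
        \<le> indicator {0<..} t * (1 - exp (- h * t))"
      by (auto simp: indicator_def algebra_simps simp flip: exp_add)
  qed (use complete_bernstein_integrable(1)[OF assms(1), of l] complete_bernstein_integrable(1)[OF assms(1), of "l + h"]
      complete_bernstein_integrable(1)[OF assms(1), of h] assms(2,3)
      in \<open>auto intro!: Bochner_Integration.integrable_diff\<close>)
  also have "\<dots> = \<phi> h"
    using complete_bernstein_integrable(2)[OF assms(1), of h] assms(3) by simp
  finally show ?thesis .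
qed

lemma gamma_weight_integral:
  "integrable lborel (\<lambda>t::real. indicator {0<..} t * (t ^ m * exp (- t) / fact m))"
  "(LINT t::real|lborel. indicator {0<..} t * (t ^ m * exp (- t) / fact m)) = 1"
proof -
  let ?g = "\<lambda>t::real. indicator {0<..} t * (t ^ m * exp (- t) / fact m)"
  have "(\<integral>\<^sup>+t. ennreal (?g t) \<partial>lborel)
      = (\<integral>\<^sup>+t. ennreal (1 / fact m) * (ennreal (t ^ m * exp (- t)) * indicator {0..} t) \<partial>lborel)"
  proof (rule nn_integral_cong_AE)
    have "AE t in lborel. t \<noteq> (0::real)" by (rule AE_lborel_singleton)
    thus "AE t in lborel. ennreal (?g t)
        = ennreal (1 / fact m) * (ennreal (t ^ m * exp (- t)) * indicator {0..} t)"
      by eventually_elim (auto simp: indicator_def simp flip: ennreal_mult)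
  qed
  also have "\<dots> = ennreal (1 / fact m) * ennreal (real_of_nat (fact m))"
    by (subst nn_integral_cmult) (auto simp: nn_intergal_power_times_exp_Ici)
  also have "\<dots> = 1"
    by (subst ennreal_mult[symmetric]) auto
  finally have *: "(\<integral>\<^sup>+t. ennreal (?g t) \<partial>lborel) = ennreal 1" by simp
  have "has_bochner_integral lborel ?g 1"
    by (rule has_bochner_integral_nn_integral[OF _ _ _ *]) (auto simp: indicator_def)
  thus "integrable lborel ?g" "integral\<^sup>L lborel ?g = 1"
    by (auto simp: has_bochner_integral_iff)
qed

lemma increment_weight_integral:
  assumes "complete_bernstein \<phi> \<mu>" and "\<phi> 1 = 1" and "m \<ge> 1"
  shows "integrable \<mu> (\<lambda>t. indicator {0<..} t * (t ^ m * exp (- t) / fact m))"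
    and "pmf (increment_pmf \<mu>) m = (LINT t|\<mu>. indicator {0<..} t * (t ^ m * exp (- t) / fact m))"
proof -
  have sets_mu [measurable_cong]: "sets \<mu> = sets borel"
    using complete_bernstein_decreasing_density[OF assms(1)] by (metis sets_density sets_lborel)
  have "t ^ m * exp (- t) / fact m \<le> 1 - exp (- t)" if "t > 0" for t :: real
  proof -
    have "(\<Sum>k\<in>{0, m}. inverse (fact k) * t ^ k) \<le> exp t"
    proof -
      have "(\<Sum>k\<in>{0, m}. inverse (fact k) * t ^ k) \<le> (\<Sum>k. inverse (fact k) * t ^ k)"
        using that summable_exp[of t] by (intro sum_le_suminf) auto
      thus ?thesis by (simp add: exp_def)
    qed
    hence "t ^ m / fact m \<le> exp t - 1"
      using \<open>m \<ge> 1\<close> by (simp add: divide_inverse mult.commute)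
    hence "(t ^ m / fact m) * exp (- t) \<le> (exp t - 1) * exp (- t)"
      by (rule mult_right_mono) simp
    thus ?thesis by (simp add: left_diff_distrib flip: exp_add)
  qed
  thus "integrable \<mu> (\<lambda>t. indicator {0<..} t * (t ^ m * exp (- t) / fact m))"
    by (intro Bochner_Integration.integrable_bound[OF complete_bernstein_integrable(1)[OF assms(1), of 1]])
      (auto intro!: AE_I2 simp: indicator_def)
  show "pmf (increment_pmf \<mu>) m = (LINT t|\<mu>. indicator {0<..} t * (t ^ m * exp (- t) / fact m))"
    using assms by (simp add: pmf_increment bernstein_coeff_def set_lebesgue_integral_def
      flip: integral_divide_zero)
qed

text \<open>Summing the Poisson-type weights under the integral gives
\<open>exp (- (1 - z) t) - exp (- t)\<close>, the difference of the integrands of \<open>\<phi> 1\<close> and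
\<open>\<phi> (1 - z)\<close>.\<close>

lemma increment_pgf:
  assumes "complete_bernstein \<phi> \<mu>" and "\<phi> 1 = 1" and "0 \<le> z" "z \<le> 1"
  shows "measure_pmf.expectation (increment_pmf \<mu>) (\<lambda>m. z ^ m) = 1 - \<phi> (1 - z)"
proof -
  have sets_mu [measurable_cong]: "sets \<mu> = sets borel"
    using complete_bernstein_decreasing_density[OF assms(1)] by (metis sets_density sets_lborel)
  define g where "g = (\<lambda>m t::real. if m = 0 then 0 else indicator {0<..} t * (t ^ m * exp (- t) / fact m))"
  have g_meas [measurable]: "g m \<in> borel_measurable \<mu>" for m
    unfolding g_def by measurable
  have g_nonneg: "z ^ m * g m t \<ge> 0" for m t
    using assms(3) by (auto simp: g_def indicator_def)
  let ?h = "\<lambda>t. indicator {0<..} t * (1 - exp (- 1 * t)) - indicator {0<..} t * (1 - exp (- (1 - z) * t))"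
  have h_nonneg: "?h t \<ge> 0" for t
    using assms(3) by (auto simp: indicator_def algebra_simps)
  have g_sums: "(\<lambda>m. z ^ m * g m t) sums ?h t" for t
  proof (cases "t > 0")
    case True
    have "(\<lambda>m. (z * t) ^ m / fact m) sums exp (z * t)"
      using exp_converges[of "z * t"] by (simp add: divide_inverse mult.commute)
    hence "(\<lambda>m. (z * t) ^ Suc m / fact (Suc m)) sums (exp (z * t) - 1)"
      by (subst sums_Suc_iff) simp
    hence "(\<lambda>m. ((z * t) ^ Suc m / fact (Suc m)) * exp (- t)) sums ((exp (z * t) - 1) * exp (- t))"
      by (rule sums_mult2)
    moreover have "(exp (z * t) - 1) * exp (- t) = ?h t"
      using True by (simp add: left_diff_distrib algebra_simps flip: exp_add)
    ultimately have "(\<lambda>m. z ^ Suc m * g (Suc m) t) sums ?h t"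
      using True by (simp add: g_def power_mult_distrib mult_ac)
    hence "(\<lambda>m. z ^ m * g m t) sums (?h t + z ^ 0 * g 0 t)"
      by (subst (asm) sums_Suc_iff)
    thus ?thesis by (simp add: g_def)
  next
    case False
    hence "(\<lambda>m. z ^ m * g m t) = (\<lambda>_. 0)" by (auto simp: g_def)
    thus ?thesis using False by simp
  qed
  have w_eq: "ennreal (pmf (increment_pmf \<mu>) m) = (\<integral>\<^sup>+t. ennreal (g m t) \<partial>\<mu>)" for m
  proof (cases "m = 0")
    case True
    thus ?thesis using assms by (simp add: g_def pmf_increment)
  next
    case False
    thus ?thesis
      using increment_weight_integral[OF assms(1,2), of m]
      by (subst nn_integral_eq_integral) (auto simp: g_def indicator_def)
  qed
  have "(\<integral>\<^sup>+m. ennreal (z ^ m) \<partial>measure_pmf (increment_pmf \<mu>))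
      = (\<Sum>m. ennreal (pmf (increment_pmf \<mu>) m) * ennreal (z ^ m))"
    by (simp add: nn_integral_measure_pmf nn_integral_count_space_nat)
  also have "\<dots> = (\<Sum>m. \<integral>\<^sup>+t. ennreal (z ^ m * g m t) \<partial>\<mu>)"
    using assms(3) by (simp add: w_eq nn_integral_multc ennreal_mult' mult.commute flip: nn_integral_cmult)
  also have "\<dots> = (\<integral>\<^sup>+t. (\<Sum>m. ennreal (z ^ m * g m t)) \<partial>\<mu>)"
    by (rule nn_integral_suminf[symmetric]) simp
  also have "\<dots> = (\<integral>\<^sup>+t. ennreal (?h t) \<partial>\<mu>)"
    using g_sums g_nonneg by (intro nn_integral_cong suminf_ennreal_eq) auto
  also have "\<dots> = ennreal (integral\<^sup>L \<mu> ?h)"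
    using h_nonneg complete_bernstein_integrable(1)[OF assms(1), of 1]
      complete_bernstein_integrable(1)[OF assms(1), of "1 - z"] assms(4)
    by (intro nn_integral_eq_integral) (auto intro!: Bochner_Integration.integrable_diff)
  also have "integral\<^sup>L \<mu> ?h = 1 - \<phi> (1 - z)"
    using complete_bernstein_integrable[OF assms(1), of 1] assms(2)
      complete_bernstein_integrable[OF assms(1), of "1 - z"] assms(4) by simp
  finally have *: "(\<integral>\<^sup>+m. ennreal (z ^ m) \<partial>measure_pmf (increment_pmf \<mu>)) = ennreal (1 - \<phi> (1 - z))" .
  have "\<phi> (1 - z) \<le> 1"
    using strict_mono_on_leD[OF complete_bernstein_strict_mono[OF assms(1,2)], of "1 - z" 1] assms by auto
  thus ?thesis
    using assms(3) * by (subst integral_eq_nn_integral) auto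
qed

text \<open>The weight at \<open>m\<close> is the mean of the decreasing density \<open>f\<close> under the Gamma law of
shape \<open>m + 1\<close>, and these laws increase stochastically in \<open>m\<close>. Concretely, the difference
of two consecutive Gamma densities integrates to zero and changes sign once, so replacing
\<open>f\<close> by the constant \<open>f (n + 1)\<close> can only decrease the integral.\<close>

lemma increment_pmf_decreasing:
  assumes "complete_bernstein \<phi> \<mu>" and "\<phi> 1 = 1" and "1 \<le> m" "m \<le> n"
  shows "pmf (increment_pmf \<mu>) n \<le> pmf (increment_pmf \<mu>) m"
  using \<open>m \<le> n\<close>
proof (induction n rule: dec_induct)
  case (step n)
  obtain f where mu: "\<mu> = density lborel (\<lambda>t. ennreal (indicator {0<..} t * f t))"
    and meas [measurable]: "(\<lambda>t. indicator {0<..} t * f t) \<in> borel_measurable borel"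
    and nonneg: "\<And>t. t > 0 \<Longrightarrow> f t \<ge> 0"
    and decr: "\<And>s t. 0 < s \<Longrightarrow> s \<le> t \<Longrightarrow> f t \<le> f s"
    using complete_bernstein_decreasing_density[OF assms(1)] by blast
  define w where "w m t = indicator {0<..} t * (t ^ m * exp (- t) / fact m)" for m and t :: real
  let ?f = "\<lambda>t. indicator {0<..} t * f t"
  have nn: "AE t in lborel. 0 \<le> ?f t" using nonneg by (auto simp: indicator_def)
  have int: "integrable lborel (\<lambda>t. ?f t * w k t)"
    and eq: "pmf (increment_pmf \<mu>) k = (LINT t|lborel. ?f t * w k t)" if "k \<ge> 1" for k
  proof -
    have [measurable]: "w k \<in> borel_measurable lborel" unfolding w_def by measurable
    show "integrable lborel (\<lambda>t. ?f t * w k t)"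
      using increment_weight_integral(1)[OF assms(1,2) that, folded w_def]
      unfolding mu by (subst (asm) integrable_real_density) (use nn in auto)
    show "pmf (increment_pmf \<mu>) k = (LINT t|lborel. ?f t * w k t)"
      using increment_weight_integral(2)[OF assms(1,2) that, folded w_def]
      unfolding mu by (subst (asm) integral_real_density) (use nn in auto)
  qed
  have gw: "integrable lborel (w k)" "integral\<^sup>L lborel (w k) = 1" for k
    using gamma_weight_integral[of k, folded w_def] by auto
  have "n \<ge> 1" using step assms(3) by simp
  have "0 = (LINT t|lborel. f (n + 1) * w n t - f (n + 1) * w (Suc n) t)"
    using gw[of n] gw[of "Suc n"] by simp
  also have "\<dots> \<le> (LINT t|lborel. ?f t * w n t - ?f t * w (Suc n) t)"
  proof (rule integral_mono)
    fix t :: real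
    show "f (n + 1) * w n t - f (n + 1) * w (Suc n) t \<le> ?f t * w n t - ?f t * w (Suc n) t"
    proof (cases "t > 0")
      case True
      \<comment> \<open>Both factors change sign at \<open>n + 1\<close>, the point where the two weights agree.\<close>
      have "0 \<le> (f t - f (n + 1)) * (1 - t / (n + 1))"
      proof (cases "t \<le> n + 1")
        case True
        thus ?thesis using decr[of t "n + 1"] \<open>t > 0\<close> by (intro mult_nonneg_nonneg) auto
      next
        case False
        thus ?thesis using decr[of "n + 1" t] by (intro mult_nonpos_nonpos) auto
      qed
      hence "0 \<le> (f t - f (n + 1)) * (1 - t / (n + 1)) * (t ^ n * exp (- t) / fact n)"
        by (rule mult_nonneg_nonneg) (use True in auto)
      also have "\<dots> = (f t - f (n + 1)) * (w n t - w (Suc n) t)"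
      proof -
        have "t ^ Suc n * exp (- t) / fact (Suc n) = (t ^ n * exp (- t) / fact n) * (t / (n + 1))"
          by (simp add: mult_ac)
        moreover have "a * (1 - q) * u = a * (u - u * q)" for a q u :: real
          by (simp add: algebra_simps)
        ultimately show ?thesis using True by (simp only: w_def) simp
      qed
      finally show ?thesis using True by (simp add: algebra_simps)
    qed (simp add: w_def)
  qed (use int[of n] int[of "Suc n"] \<open>n \<ge> 1\<close> gw in \<open>auto intro!: Bochner_Integration.integrable_diff\<close>)
  also have "\<dots> = pmf (increment_pmf \<mu>) n - pmf (increment_pmf \<mu>) (Suc n)"
    using int[of n] int[of "Suc n"] eq[of n] eq[of "Suc n"] \<open>n \<ge> 1\<close>
    by simp
  finally show ?case using step.IH by simp
qed simp

section \<open>Consequences of the scaling condition\<close>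

lemma bernstein_scaling:
  assumes "complete_bernstein \<phi> \<mu>" and "\<phi> 0 = 0" and "\<phi> 1 = 1" and "scaling_condition \<phi>"
  obtains c1 c2 \<alpha>1 \<alpha>2 where "c1 > 0" "c2 > 0" "\<alpha>1 > 0" "\<alpha>2 < 1"
    and "\<And>r R. 0 < r \<Longrightarrow> r \<le> R \<Longrightarrow> R \<le> 1 \<Longrightarrow> c1 * (R / r) powr \<alpha>1 * \<phi> r \<le> \<phi> R"
    and "\<And>r R. 0 < r \<Longrightarrow> r \<le> R \<Longrightarrow> R \<le> 1 \<Longrightarrow> \<phi> R \<le> c2 * (R / r) powr \<alpha>2 * \<phi> r"
proof -
  obtain c1 c2 \<alpha>1 \<alpha>2 where c: "c1 > 0" "c2 > 0" "\<alpha>1 > 0" "\<alpha>2 < 1"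
    and *: "\<And>r R. 0 < r \<Longrightarrow> r \<le> R \<Longrightarrow> R \<le> 1 \<Longrightarrow>
       c1 * (R / r) powr \<alpha>1 \<le> \<phi> R / \<phi> r \<and> \<phi> R / \<phi> r \<le> c2 * (R / r) powr \<alpha>2"
    using assms(4) unfolding scaling_condition_def by metis
  have "\<phi> r > 0" if "r > 0" for r
    using strict_mono_onD[OF complete_bernstein_strict_mono[OF assms(1,3)], of 0 r] that assms(2) by auto
  thus ?thesis
    using * by (intro that[OF c]) (auto simp: field_simps)
qed

text \<open>The value \<open>1 / n\<close> is attained by the intermediate value theorem: the lower scaling
bound makes \<open>\<phi>\<close> small near the origin, and subadditivity carries this modulus of continuity to the
whole interval. Injectivity on the entire half-line is what makes the inverse well defined there.\<close>

lemma bernstein_inverse: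
  assumes "complete_bernstein \<phi> \<mu>" and "\<phi> 0 = 0" and "\<phi> 1 = 1" and "scaling_condition \<phi>"
    and "n \<ge> (1::nat)"
  shows "0 < the_inv_into {0..} \<phi> (1 / real n)" "the_inv_into {0..} \<phi> (1 / real n) \<le> 1"
    and "\<phi> (the_inv_into {0..} \<phi> (1 / real n)) = 1 / real n"
proof -
  obtain c1 c2 \<alpha>1 \<alpha>2 where c: "c1 > 0" "\<alpha>1 > 0"
    and low: "\<And>r R. 0 < r \<Longrightarrow> r \<le> R \<Longrightarrow> R \<le> 1 \<Longrightarrow> c1 * (R / r) powr \<alpha>1 * \<phi> r \<le> \<phi> R"
    using bernstein_scaling[OF assms(1-4)] by metis
  have sm: "strict_mono_on {0..} \<phi>" by (rule complete_bernstein_strict_mono[OF assms(1,3)])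
  \<comment> \<open>The lower scaling bound with \<open>R = 1\<close>.\<close>
  have small: "\<phi> h \<le> h powr \<alpha>1 / c1" if "0 \<le> h" "h \<le> 1" for h
  proof (cases "h = 0")
    case False
    hence "c1 * (1 / h) powr \<alpha>1 * \<phi> h \<le> 1" using low[of h 1] that assms(3) by simp
    thus ?thesis using that False c by (simp add: powr_divide field_simps)
  qed (simp add: assms(2))
  have lip: "\<phi> y - \<phi> x \<le> (y - x) powr \<alpha>1 / c1" if "0 \<le> x" "x \<le> y" "y \<le> 1" for x y
    using complete_bernstein_increment_le[OF assms(1), of x "y - x"] small[of "y - x"] that by simp
  have "continuous_on {0..1} \<phi>"
    unfolding continuous_on_def
  proof
    fix x :: real assume x: "x \<in> {0..1}"
    have "((\<lambda>y. \<phi> y - \<phi> x) \<longlongrightarrow> 0) (at x within {0..1})"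
    proof (rule Lim_null_comparison)
      have "\<bar>\<phi> y - \<phi> x\<bar> \<le> \<bar>y - x\<bar> powr \<alpha>1 / c1" if "y \<in> {0..1}" for y
        using lip[of x y] lip[of y x] strict_mono_on_leD[OF sm, of x y] strict_mono_on_leD[OF sm, of y x] x that
        by (cases "x \<le> y") auto
      thus "\<forall>\<^sub>F y in at x within {0..1}. norm (\<phi> y - \<phi> x) \<le> \<bar>y - x\<bar> powr \<alpha>1 / c1"
        by (auto simp: eventually_at_filter)
      have "((\<lambda>y. \<bar>y - x\<bar> powr \<alpha>1) \<longlongrightarrow> 0) (at x within {0..1})"
        by (rule tendsto_zero_powrI[OF _ tendsto_const]) (use c in \<open>auto intro!: tendsto_eq_intros\<close>)
      thus "((\<lambda>y. \<bar>y - x\<bar> powr \<alpha>1 / c1) \<longlongrightarrow> 0) (at x within {0..1})"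
        by (rule tendsto_divide_zero)
    qed
    thus "(\<phi> \<longlongrightarrow> \<phi> x) (at x within {0..1})" by (rule LIM_zero_cancel)
  qed
  then obtain u where u: "0 \<le> u" "u \<le> 1" "\<phi> u = 1 / real n"
    using IVT'[of \<phi> 0 "1 / real n" 1] assms by auto
  have "inj_on \<phi> {0..}" using sm by (rule strict_mono_on_imp_inj_on)
  hence "the_inv_into {0..} \<phi> (1 / real n) = u"
    using the_inv_into_f_f[of \<phi> "{0..}" u] u by simp
  moreover have "u \<noteq> 0" using u assms by auto
  ultimately show "0 < the_inv_into {0..} \<phi> (1 / real n)" "the_inv_into {0..} \<phi> (1 / real n) \<le> 1"
    "\<phi> (the_inv_into {0..} \<phi> (1 / real n)) = 1 / real n"
    using u by auto
qed

lemma integrable_pmf_unit_interval: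
  fixes f :: "'a \<Rightarrow> real"
  assumes "\<And>x. 0 \<le> f x" "\<And>x. f x \<le> 1"
  shows "integrable (measure_pmf p) f"
  by (rule measure_pmf.integrable_const_bound[where B = 1]) (use assms in auto)

text \<open>Choosing \<open>z = 1 - 1 / N\<close> in the generating function replaces the Laplace transform at \<open>1 / N\<close>;
\<open>1 - z ^ m\<close> is comparable to \<open>min 1 (m / N)\<close>.\<close>

lemma one_minus_power_bounds:
  fixes N m :: nat
  assumes "N \<ge> 1"
  shows "1 - (1 - 1 / real N) ^ m \<le> min 1 (real m / real N)"
    and "min 1 (real m / real N) \<le> 2 * (1 - (1 - 1 / real N) ^ m)"
proof -
  have "1 + real m * (- (1 / real N)) \<le> (1 + - (1 / real N)) ^ m"
    using assms by (intro Bernoulli_inequality) auto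
  moreover have "0 \<le> (1 - 1 / real N) ^ m"
    using assms by (intro zero_le_power) auto
  ultimately show "1 - (1 - 1 / real N) ^ m \<le> min 1 (real m / real N)" by simp
  define x where "x = min 1 (real m / real N)"
  have x: "0 \<le> x" "x \<le> 1" "x \<le> real m / real N" by (auto simp: x_def)
  have "(1 - 1 / real N) ^ m \<le> exp (- 1 / real N) ^ m"
    using assms exp_ge_add_one_self[of "- 1 / real N"] by (intro power_mono) auto
  also have "\<dots> = exp (- (real m / real N))"
    by (simp flip: exp_of_nat_mult)
  also have "\<dots> \<le> exp (- x)" using x by simp
  also have "\<dots> \<le> 1 - x / 2"
  proof -
    have "exp (- x) * (1 + x) \<le> exp (- x) * exp x"
      using exp_ge_add_one_self[of x] by (intro mult_left_mono) auto
    hence "exp (- x) * (1 + x) \<le> 1" by (simp flip: exp_add)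
    hence "exp (- x) \<le> 1 / (1 + x)" using x by (simp add: field_simps)
    also have "\<dots> \<le> 1 - x / 2"
    proof -
      have "x * x \<le> x * 1" using x by (intro mult_left_mono) auto
      hence "1 \<le> (1 - x / 2) * (1 + x)" by (simp add: algebra_simps)
      thus ?thesis using x by (simp add: field_simps)
    qed
    finally show ?thesis .
  qed
  finally show "min 1 (real m / real N) \<le> 2 * (1 - (1 - 1 / real N) ^ m)"
    by (simp add: x_def)
qed

lemma truncated_mean_bounds:
  assumes "complete_bernstein \<phi> \<mu>" and "\<phi> 1 = 1" and "N \<ge> (1::nat)"
  shows "\<phi> (1 / real N) \<le> measure_pmf.expectation (increment_pmf \<mu>) (\<lambda>m. min 1 (real m / real N))"
    and "measure_pmf.expectation (increment_pmf \<mu>) (\<lambda>m. min 1 (real m / real N)) \<le> 2 * \<phi> (1 / real N)"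
proof -
  let ?p = "measure_pmf (increment_pmf \<mu>)"
  let ?z = "1 - 1 / real N"
  have z: "0 \<le> ?z" "?z \<le> 1" using assms(3) by auto
  have i1: "integrable ?p (\<lambda>m. ?z ^ m)"
    using z by (intro integrable_pmf_unit_interval) (auto intro!: power_le_one zero_le_power)
  have i2: "integrable ?p (\<lambda>m. min 1 (real m / real N))"
    by (intro integrable_pmf_unit_interval) auto
  have eq: "measure_pmf.expectation (increment_pmf \<mu>) (\<lambda>m. 1 - ?z ^ m) = \<phi> (1 / real N)"
    using increment_pgf[OF assms(1,2) z] i1 by simp
  have "measure_pmf.expectation (increment_pmf \<mu>) (\<lambda>m. 1 - ?z ^ m)
      \<le> measure_pmf.expectation (increment_pmf \<mu>) (\<lambda>m. min 1 (real m / real N))"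
    using one_minus_power_bounds(1)[OF assms(3)] i1 i2 by (intro integral_mono) auto
  thus "\<phi> (1 / real N) \<le> measure_pmf.expectation (increment_pmf \<mu>) (\<lambda>m. min 1 (real m / real N))"
    using eq by simp
  have "measure_pmf.expectation (increment_pmf \<mu>) (\<lambda>m. min 1 (real m / real N))
      \<le> measure_pmf.expectation (increment_pmf \<mu>) (\<lambda>m. 2 * (1 - ?z ^ m))"
    using one_minus_power_bounds(2)[OF assms(3)] i1 i2 by (intro integral_mono) auto
  thus "measure_pmf.expectation (increment_pmf \<mu>) (\<lambda>m. min 1 (real m / real N)) \<le> 2 * \<phi> (1 / real N)"
    using eq i1 by simp
qed

lemma ex_nat_powr_small:
  fixes \<alpha> \<epsilon> :: real
  assumes "\<alpha> > 0" "\<epsilon> > 0"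
  obtains N :: nat where "N \<ge> 1" "real N powr (- \<alpha>) \<le> \<epsilon>"
proof -
  have "((\<lambda>n. real n powr (- \<alpha>)) \<longlongrightarrow> 0) sequentially"
    using assms by (intro tendsto_neg_powr filterlim_real_sequentially) auto
  hence "\<forall>\<^sub>F n in sequentially. real n powr (- \<alpha>) < \<epsilon>"
    using assms(2) by (rule order_tendstoD)
  moreover have "\<forall>\<^sub>F n in sequentially. n \<ge> (1::nat)" by (rule eventually_ge_at_top)
  ultimately have "\<forall>\<^sub>F n in sequentially. n \<ge> 1 \<and> real n powr (- \<alpha>) < \<epsilon>"
    by eventually_elim auto
  then obtain N where "\<forall>n\<ge>N. n \<ge> 1 \<and> real n powr (- \<alpha>) < \<epsilon>"
    unfolding eventually_sequentially by blast
  thus ?thesis using that[of N] by auto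
qed

text \<open>Compare the truncated means at the scales \<open>N\<close>, \<open>D N\<close> and \<open>B N\<close> with \<open>1 \<ll> D \<ll> B\<close>.
In the mean at scale \<open>D N\<close>, which is at least \<open>\<phi> (1 / (D N))\<close>, values up to \<open>N\<close> contribute at
most a quarter of this bound, because the upper
exponent is below one, and values beyond \<open>B N\<close> at most a quarter, because the lower
exponent is positive. The remaining half comes from \<open>P(N < R \<le> B N)\<close>, which by monotonicity of the
weights is at most \<open>B N \<cdot> P(R = N)\<close>.\<close>

lemma increment_pmf_lower_bound:
  assumes "complete_bernstein \<phi> \<mu>" and "\<phi> 0 = 0" and "\<phi> 1 = 1" and "scaling_condition \<phi>"
  obtains c where "c > 0" "\<And>N. N \<ge> 1 \<Longrightarrow> pmf (increment_pmf \<mu>) N \<ge> c * \<phi> (1 / real N) / real N"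
proof -
  obtain c1 c2 \<alpha>1 \<alpha>2 where c: "c1 > 0" "c2 > 0" "\<alpha>1 > 0" "\<alpha>2 < 1"
    and low: "\<And>r R. 0 < r \<Longrightarrow> r \<le> R \<Longrightarrow> R \<le> 1 \<Longrightarrow> c1 * (R / r) powr \<alpha>1 * \<phi> r \<le> \<phi> R"
    and up: "\<And>r R. 0 < r \<Longrightarrow> r \<le> R \<Longrightarrow> R \<le> 1 \<Longrightarrow> \<phi> R \<le> c2 * (R / r) powr \<alpha>2 * \<phi> r"
    using bernstein_scaling[OF assms(1-4)] by metis
  \<comment> \<open>\<open>D\<close> and \<open>K\<close> make the contributions of values below \<open>N\<close> and beyond \<open>B N\<close> at most a quarter each.\<close>
  obtain D :: nat where D: "D \<ge> 1" "real D powr (- (1 - \<alpha>2)) \<le> 1 / (8 * c2)"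
    using ex_nat_powr_small[of "1 - \<alpha>2" "1 / (8 * c2)"] c by auto
  obtain K :: nat where K: "K \<ge> 1" "real K powr (- \<alpha>1) \<le> c1 / 8"
    using ex_nat_powr_small[of "\<alpha>1" "c1 / 8"] c by auto
  define B where "B = K * D"
  have B: "B \<ge> D" "B \<ge> 1" using D K by (auto simp: B_def)
  let ?p = "measure_pmf (increment_pmf \<mu>)"
  let ?a = "pmf (increment_pmf \<mu>)"
  let ?E = "measure_pmf.expectation (increment_pmf \<mu>)"
  let ?c = "1 / (2 * real B * c2 * real D powr \<alpha>2)"
  define T where "T n m = min 1 (real m / real n)" for n m :: nat
  have T: "0 \<le> T n m" "T n m \<le> 1" "integrable ?p (T n)" for n m
    unfolding T_def by (auto intro: integrable_pmf_unit_interval)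
  have ET: "\<phi> (1 / real n) \<le> ?E (T n)" "?E (T n) \<le> 2 * \<phi> (1 / real n)" if "n \<ge> 1" for n
    unfolding T_def using truncated_mean_bounds[OF assms(1,3) that] by auto
  have "?a N \<ge> ?c * \<phi> (1 / real N) / real N" if N: "N \<ge> 1" for N
  proof -
    define r where "r = 1 / real (D * N)"
    have r: "0 < r" "r \<le> 1" using D N by (auto simp: r_def field_simps simp flip: of_nat_mult)
    have phi_pos: "\<phi> r \<ge> 0" using complete_bernstein_nonneg[OF assms(1)] r by auto
    have upN: "\<phi> (1 / real N) \<le> c2 * real D powr \<alpha>2 * \<phi> r"
      using up[of r "1 / real N"] r D N by (auto simp: r_def field_simps)
    have int: "integrable ?p (indicator {N<..B * N} :: nat \<Rightarrow> real)"
      by (intro integrable_pmf_unit_interval) (auto simp: indicator_def)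
    \<comment> \<open>The three terms dominate on \<open>m \<le> N\<close>, \<open>N < m \<le> B N\<close> and \<open>m > B N\<close>, respectively.\<close>
    have pw: "T (D * N) m \<le> 1 / real D * T N m
        + indicator {N<..B * N} m + T (B * N) m" for m
    proof -
      consider "m \<le> N" | "N < m" "m \<le> B * N" | "m > B * N" by linarith
      thus ?thesis
      proof cases
        case 1
        have "T (D * N) m \<le> 1 / real D * (real m / real N)" by (simp add: T_def)
        also have "\<dots> = 1 / real D * T N m"
          using 1 N by (simp add: T_def min_def field_simps)
        also have "\<dots> \<le> \<dots> + indicator {N<..B * N} m + T (B * N) m"
          using T(1)[of "B * N" m] by (simp add: indicator_def)
        finally show ?thesis .
      next
        case 2
        have "T (D * N) m \<le> indicator {N<..B * N} m" using 2 T(2) by simp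
        moreover have "0 \<le> 1 / real D * T N m" "0 \<le> T (B * N) m" using T(1) by auto
        ultimately show ?thesis by linarith
      next
        case 3
        have "1 \<le> real m / real (B * N)" using 3 N B by (simp add: field_simps flip: of_nat_mult)
        hence "T (D * N) m \<le> T (B * N) m" by (auto simp: T_def)
        moreover have "0 \<le> 1 / real D * T N m" using T(1) by auto
        ultimately show ?thesis by (smt (verit) indicator_pos_le)
      qed
    qed
    have "\<phi> r \<le> ?E (T (D * N))"
      using ET(1)[of "D * N"] D N by (simp add: r_def)
    also have "\<dots> \<le> ?E (\<lambda>m. 1 / real D * T N m
        + indicator {N<..B * N} m + T (B * N) m)"
      using pw T(3) int by (intro integral_mono Bochner_Integration.integrable_add) auto
    also have "\<dots> = 1 / real D * ?E (T N)
        + measure ?p {N<..B * N} + ?E (T (B * N))"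
      using T(3) int by simp
    also have "1 / real D * ?E (T N) \<le> \<phi> r / 4"
    proof -
      have "1 / real D * ?E (T N) \<le> 1 / real D * (2 * (c2 * real D powr \<alpha>2 * \<phi> r))"
        using ET(2)[OF N] upN by (intro mult_left_mono) auto
      also have "\<dots> = 2 * c2 * \<phi> r * real D powr (- (1 - \<alpha>2))"
        using D by (simp add: powr_diff)
      also have "\<dots> \<le> 2 * c2 * \<phi> r * (1 / (8 * c2))"
        using D c phi_pos by (intro mult_left_mono) auto
      finally show ?thesis using c by simp
    qed
    also have "?E (T (B * N)) \<le> \<phi> r / 4"
    proof -
      define s where "s = 1 / real (B * N)"
      have s: "0 < s" "s \<le> r" "r / s = real K"
        using B D K N by (auto simp: s_def r_def field_simps B_def)
      have "\<phi> s * c1 \<le> \<phi> r * real K powr (- \<alpha>1)"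
        using low[of s r] s r K by (simp add: powr_minus field_simps)
      also have "\<dots> \<le> \<phi> r * (c1 / 8)"
        using K phi_pos by (intro mult_left_mono) auto
      finally have "\<phi> s \<le> \<phi> r / 8" using c by simp
      moreover have "?E (T (B * N)) \<le> 2 * \<phi> s"
        using ET(2)[of "B * N"] B N by (simp add: s_def)
      ultimately show ?thesis by simp
    qed
    also have "measure ?p {N<..B * N} \<le> real (B * N) * ?a N"
    proof -
      have "measure ?p {N<..B * N} = (\<Sum>m\<in>{N<..B * N}. ?a m)" by (simp add: measure_measure_pmf_finite)
      also have "\<dots> \<le> real (card {N<..B * N}) * ?a N"
        using N by (intro sum_bounded_above increment_pmf_decreasing[OF assms(1,3)]) auto
      also have "\<dots> \<le> real (B * N) * ?a N" by (intro mult_right_mono of_nat_mono) auto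
      finally show ?thesis .
    qed
    finally have *: "\<phi> r \<le> 2 * (real (B * N) * ?a N)" by simp
    have "\<phi> (1 / real N) \<le> c2 * real D powr \<alpha>2 * (2 * (real (B * N) * ?a N))"
      using c by (intro order_trans[OF upN mult_left_mono[OF *]]) simp
    thus ?thesis using c D N B by (simp add: field_simps)
  qed
  moreover have "?c > 0" using c D B by simp
  ultimately show ?thesis using that by blast
qed

section \<open>Laws of partial sums\<close>

primrec convolution_power :: "'a::comm_monoid_add pmf \<Rightarrow> nat \<Rightarrow> 'a pmf" where
  "convolution_power p 0 = return_pmf 0"
| "convolution_power p (Suc n) =
     bind_pmf p (\<lambda>s. map_pmf (\<lambda>x. s + x) (convolution_power p n))"

lemma convolution_power_add:
  "convolution_power p (m + n) =
     bind_pmf (convolution_power p m) (\<lambda>x. map_pmf (\<lambda>y. x + y) (convolution_power p n))"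
proof (induction m)
  case 0
  have "(\<lambda>y. 0 + y) = (id :: 'a \<Rightarrow> 'a)" by auto
  thus ?case unfolding add_0 convolution_power.simps bind_return_pmf
    by (simp only: pmf.map_id id_apply)
next
  case (Suc m)
  show ?case
    by (simp add: Suc.IH bind_assoc_pmf map_bind_pmf bind_map_pmf map_pmf_comp o_def flip: add.assoc)
qed

lemma measure_convolution_power_add:
  assumes "\<And>x y. x \<in> A \<Longrightarrow> y \<in> B \<Longrightarrow> x + y \<in> C"
  shows "measure (measure_pmf (convolution_power p m)) A * measure (measure_pmf (convolution_power p n)) B
    \<le> measure (measure_pmf (convolution_power p (m + n))) C"
proof -
  let ?P = "\<lambda>m. measure_pmf (convolution_power p m)"
  have "emeasure (?P m) A * emeasure (?P n) B = (\<integral>\<^sup>+x. indicator A x * emeasure (?P n) B \<partial>?P m)"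
    by (simp add: nn_integral_multc)
  also have "\<dots> \<le> (\<integral>\<^sup>+x. emeasure (?P n) ((\<lambda>y. x + y) -` C) \<partial>?P m)"
    using assms by (intro nn_integral_mono) (auto simp: indicator_def intro!: emeasure_mono)
  also have "\<dots> = emeasure (?P (m + n)) C"
    by (simp add: convolution_power_add)
  finally show ?thesis
    by (simp add: measure_pmf.emeasure_eq_measure flip: ennreal_mult)
qed

text \<open>Splitting off the first coordinate of the i.i.d. sequence matches the recursion of
\<open>convolution_power\<close>. Countability of the value type makes addition measurable for the
discrete sigma algebra.\<close>

lemma distr_partial_sum:
  fixes p :: "'a::comm_monoid_add pmf"
  assumes cnt: "countable (UNIV :: 'a set)"
  shows "(\<lambda>\<omega>. \<Sum>i<n. \<omega> i) \<in> PiM UNIV (\<lambda>_::nat. measure_pmf p) \<rightarrow>\<^sub>M count_space UNIV"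
    and "distr (PiM UNIV (\<lambda>_::nat. measure_pmf p)) (count_space UNIV) (\<lambda>\<omega>. \<Sum>i<n. \<omega> i)
           = measure_pmf (convolution_power p n)"
proof -
  interpret sequence_space "measure_pmf p" ..
  have add_meas: "(\<lambda>x. f x + g x) \<in> M \<rightarrow>\<^sub>M count_space UNIV"
    if "f \<in> M \<rightarrow>\<^sub>M count_space UNIV" "g \<in> M \<rightarrow>\<^sub>M count_space UNIV"
    for f g :: "'b \<Rightarrow> 'a" and M
  proof -
    have "(\<lambda>x. (f x, g x)) \<in> M \<rightarrow>\<^sub>M count_space UNIV \<Otimes>\<^sub>M count_space UNIV"
      using that by (rule measurable_Pair)
    hence "(\<lambda>x. (f x, g x)) \<in> M \<rightarrow>\<^sub>M count_space (UNIV \<times> UNIV)"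
      using cnt by (simp add: pair_measure_countable)
    from measurable_compose[OF this, of "\<lambda>(a, b). a + b" "count_space UNIV"] show ?thesis by simp
  qed
  show meas: "(\<lambda>\<omega>. \<Sum>i<n. \<omega> i) \<in> S \<rightarrow>\<^sub>M count_space UNIV" for n
  proof (induction n)
    case (Suc n)
    have "(\<lambda>\<omega>. \<omega> n) \<in> S \<rightarrow>\<^sub>M measure_pmf p" by simp
    also have "measurable S (measure_pmf p) = measurable S (count_space UNIV)"
      by (rule measurable_cong_sets) auto
    finally show ?case using add_meas[OF Suc] by simp
  qed simp
  show "distr S (count_space UNIV) (\<lambda>\<omega>. \<Sum>i<n. \<omega> i) = measure_pmf (convolution_power p n)"
  proof (induction n)
    case 0
    show ?case by (rule measure_eqI)
      (auto simp: emeasure_distr emeasure_space_1 indicator_def)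
  next
    case (Suc n)
    show ?case
    proof (rule measure_eqI)
      fix A assume "A \<in> sets (distr S (count_space UNIV) (\<lambda>\<omega>. \<Sum>i<Suc n. \<omega> i))"
      let ?h = "\<lambda>(s, \<omega>). case_nat s \<omega> :: nat \<Rightarrow> 'a"
      have "emeasure (distr S (count_space UNIV) (\<lambda>\<omega>. \<Sum>i<Suc n. \<omega> i)) A
          = emeasure (distr (distr (measure_pmf p \<Otimes>\<^sub>M S) S ?h) (count_space UNIV)
              (\<lambda>\<omega>. \<Sum>i<Suc n. \<omega> i)) A"
        by (simp only: PiM_iter)
      also have "\<dots> = emeasure (distr (measure_pmf p \<Otimes>\<^sub>M S) (count_space UNIV)
              ((\<lambda>\<omega>. \<Sum>i<Suc n. \<omega> i) \<circ> ?h)) A"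
        by (subst distr_distr[OF meas]) auto
      also have "(\<lambda>\<omega>. \<Sum>i<Suc n. \<omega> i) \<circ> ?h = (\<lambda>(s, \<omega>). s + (\<Sum>i<n. \<omega> i))"
        by (auto simp: fun_eq_iff sum.lessThan_Suc_shift simp del: sum.lessThan_Suc)
      also have "emeasure (distr (measure_pmf p \<Otimes>\<^sub>M S) (count_space UNIV) (\<lambda>(s, \<omega>). s + (\<Sum>i<n. \<omega> i))) A
        = (\<integral>\<^sup>+s. emeasure S {\<omega> \<in> space S. s + (\<Sum>i<n. \<omega> i) \<in> A} \<partial>p)"
      proof -
        have m: "(\<lambda>(s, \<omega>). s + (\<Sum>i<n. \<omega> i)) \<in> measure_pmf p \<Otimes>\<^sub>M S \<rightarrow>\<^sub>M count_space UNIV"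
        proof -
          have "fst \<in> measure_pmf p \<Otimes>\<^sub>M S \<rightarrow>\<^sub>M measure_pmf p" by simp
          also have "measurable (measure_pmf p \<Otimes>\<^sub>M S) (measure_pmf p)
              = measurable (measure_pmf p \<Otimes>\<^sub>M S) (count_space UNIV)"
            by (rule measurable_cong_sets) auto
          finally have f: "fst \<in> measure_pmf p \<Otimes>\<^sub>M S \<rightarrow>\<^sub>M count_space UNIV" .
          show ?thesis
            using add_meas[OF f measurable_compose[OF measurable_snd meas[of n]]]
            by (simp add: case_prod_beta)
        qed
        show ?thesis
          by (subst emeasure_distr[OF m], simp,
              subst P.emeasure_pair_measure_alt[OF measurable_sets[OF m]])
            (auto simp: space_pair_measure vimage_def intro!: nn_integral_cong arg_cong[where f="emeasure S"])
      qed
      also have "\<dots> = (\<integral>\<^sup>+s. emeasure (distr S (count_space UNIV) (\<lambda>\<omega>. \<Sum>i<n. \<omega> i)) {x. s + x \<in> A} \<partial>p)"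
        by (intro nn_integral_cong, subst emeasure_distr[OF meas])
          (auto intro!: arg_cong[where f="emeasure S"])
      also have "\<dots> = emeasure (measure_pmf (convolution_power p (Suc n))) A"
        by (simp add: Suc.IH vimage_def)
      finally show "emeasure (distr S (count_space UNIV) (\<lambda>\<omega>. \<Sum>i<Suc n. \<omega> i)) A
          = emeasure (measure_pmf (convolution_power p (Suc n))) A" .
    qed simp
  qed
qed

text \<open>The clock and the walk are independent, and the events \<open>\<tau>\<^sub>n = m\<close> are disjoint for different \<open>m\<close>.\<close>

lemma transition_prob_ge_sum:
  fixes x y :: "int ^ 'd::finite"
  assumes "finite I"
  shows "(\<Sum>m\<in>I. pmf (convolution_power (increment_pmf \<mu>) n) m *
            pmf (convolution_power step_pmf m) (y - x)) \<le> transition_prob \<mu> n x y"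
proof -
  let ?A = "PiM UNIV (\<lambda>_::nat. measure_pmf (step_pmf :: (int ^ 'd) pmf))"
  let ?B = "PiM UNIV (\<lambda>_::nat. measure_pmf (increment_pmf \<mu>))"
  interpret A: sequence_space "measure_pmf (step_pmf :: (int ^ 'd) pmf)" ..
  interpret B: sequence_space "measure_pmf (increment_pmf \<mu>)" ..
  interpret P: pair_prob_space ?A ?B ..
  have cnt: "countable (UNIV :: (int ^ 'd) set)"
    using countable_vector[of "\<lambda>_::'d. UNIV :: int set"] by simp
  note mA = distr_partial_sum[OF cnt, where p = step_pmf]
  note mB = distr_partial_sum[OF countableI_type, where p = "increment_pmf \<mu>"]
  define E where "E m = {\<xi> \<in> space ?A. (\<Sum>i<m. \<xi> i) = y - x}" for m
  define F where "F m = {\<rho> \<in> space ?B. (\<Sum>i<n. \<rho> i) = m}" for m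
  have E [measurable]: "E m \<in> sets ?A" for m
  proof -
    have "E m = (\<lambda>\<omega>. \<Sum>i<m. \<omega> i) -` {y - x} \<inter> space ?A" by (auto simp: E_def)
    thus ?thesis using measurable_sets[OF mA(1)] by simp
  qed
  have F [measurable]: "F m \<in> sets ?B" for m
  proof -
    have "F m = (\<lambda>\<omega>. \<Sum>i<n. \<omega> i) -` {m} \<inter> space ?B" by (auto simp: F_def)
    thus ?thesis using measurable_sets[OF mB(1)] by simp
  qed
  have mE: "measure ?A (E m) = pmf (convolution_power step_pmf m) (y - x)" for m
    using measure_distr[OF mA(1)[of m], of "{y - x}"]
    by (simp add: mA(2) measure_pmf_single E_def vimage_def Int_def conj_commute)
  have mF: "measure ?B (F m) = pmf (convolution_power (increment_pmf \<mu>) n) m" for m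
    using measure_distr[OF mB(1)[of n], of "{m}"]
    by (simp add: mB(2) measure_pmf_single F_def vimage_def Int_def conj_commute)
  have ev: "{\<omega> \<in> space (walk_space \<mu>). subordinate_walk x \<omega> n = y} = (\<Union>m. E m \<times> F m)"
    by (auto simp: walk_space_def space_pair_measure subordinate_walk_def simple_walk_def
        subordinator_def E_def F_def algebra_simps)
  have "(\<Sum>m\<in>I. pmf (convolution_power (increment_pmf \<mu>) n) m *
            pmf (convolution_power step_pmf m) (y - x)) = (\<Sum>m\<in>I. measure (?A \<Otimes>\<^sub>M ?B) (E m \<times> F m))"
    by (intro sum.cong refl) (simp add: measure_def B.P.emeasure_pair_measure_Times enn2real_mult flip: mE mF)
  also have "\<dots> = measure (?A \<Otimes>\<^sub>M ?B) (\<Union>m\<in>I. E m \<times> F m)"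
    using assms by (intro P.finite_measure_finite_Union[symmetric])
      (auto simp: disjoint_family_on_def F_def)
  also have "\<dots> \<le> measure (?A \<Otimes>\<^sub>M ?B) (\<Union>m. E m \<times> F m)"
    by (rule P.finite_measure_mono) auto
  finally show ?thesis
    unfolding transition_prob_def ev by (simp add: walk_space_def)
qed

section \<open>Lower bounds for the law of the subordinator\<close>

lemma convolution_power_pgf:
  fixes p :: "nat pmf" and z :: real
  assumes "0 \<le> z" "z \<le> 1"
  shows "measure_pmf.expectation (convolution_power p n) (\<lambda>m. z ^ m)
           = measure_pmf.expectation p (\<lambda>m. z ^ m) ^ n"
proof -
  have nn: "ennreal (measure_pmf.expectation q (\<lambda>m. z ^ m)) = (\<integral>\<^sup>+m. ennreal (z ^ m) \<partial>measure_pmf q)"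
    for q :: "nat pmf"
    using assms by (intro nn_integral_eq_integral[symmetric] integrable_pmf_unit_interval)
      (auto intro: power_le_one)
  have "(\<integral>\<^sup>+m. ennreal (z ^ m) \<partial>measure_pmf (convolution_power p n))
      = (\<integral>\<^sup>+m. ennreal (z ^ m) \<partial>measure_pmf p) ^ n"
  proof (induction n)
    case (Suc n)
    show ?case
      using assms by (simp add: power_add ennreal_mult nn_integral_cmult nn_integral_multc Suc.IH)
  qed simp
  hence "ennreal (measure_pmf.expectation (convolution_power p n) (\<lambda>m. z ^ m))
      = ennreal (measure_pmf.expectation p (\<lambda>m. z ^ m) ^ n)"
    using assms by (simp add: nn ennreal_power flip: nn)
  thus ?thesis using assms by (subst (asm) ennreal_inj) auto
qed

text \<open>Markov's inequality for \<open>1 - z ^ \<tau>\<^sub>n\<close> with \<open>z = 1 - 1 / N\<close>, combined with Bernoulli's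
inequality for the generating function \<open>(1 - \<phi> (1 / N)) ^ n\<close>.\<close>

lemma subordinator_bounded:
  assumes "complete_bernstein \<phi> \<mu>" and "\<phi> 1 = 1" and "N \<ge> (1::nat)"
  shows "measure (measure_pmf (convolution_power (increment_pmf \<mu>) n)) {..N} \<ge> 1 - 2 * real n * \<phi> (1 / real N)"
proof -
  let ?q = "convolution_power (increment_pmf \<mu>) n"
  let ?z = "1 - 1 / real N"
  have z: "0 \<le> ?z" "?z \<le> 1" using assms(3) by auto
  have "\<phi> (1 / real N) \<le> 1"
    using strict_mono_on_leD[OF complete_bernstein_strict_mono[OF assms(1,2)], of "1 / real N" 1] assms by auto
  hence "1 + real n * (- \<phi> (1 / real N)) \<le> (1 + - \<phi> (1 / real N)) ^ n"
    by (intro Bernoulli_inequality) auto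
  also have "\<dots> = measure_pmf.expectation ?q (\<lambda>m. ?z ^ m)"
    using convolution_power_pgf[OF z, of "increment_pmf \<mu>" n] increment_pgf[OF assms(1,2) z] by simp
  also have "\<dots> \<le> measure_pmf.expectation ?q (\<lambda>m. (1 + indicator {..N} m) / 2)"
  proof (rule integral_mono)
    fix m :: nat
    show "?z ^ m \<le> (1 + indicator {..N} m) / 2"
    proof (cases "m \<le> N")
      case True
      thus ?thesis using z by (simp add: power_le_one)
    next
      case False
      hence "min 1 (real m / real N) = 1" using assms(3) by (simp add: min_def field_simps)
      thus ?thesis using one_minus_power_bounds(2)[OF assms(3), of m] False by simp
    qed
  qed (use z in \<open>auto intro!: integrable_pmf_unit_interval power_le_one simp: indicator_def\<close>)
  also have "\<dots> = (1 + measure (measure_pmf ?q) {..N}) / 2"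
  proof -
    have "integrable (measure_pmf ?q) (indicator {..N} :: nat \<Rightarrow> real)"
      by (intro integrable_pmf_unit_interval) (auto simp: indicator_def)
    thus ?thesis by simp
  qed
  finally show ?thesis by simp
qed

lemma pmf_convolution_power_Suc_nat:
  fixes p :: "nat pmf"
  shows "pmf (convolution_power p (Suc n)) m = (\<Sum>j\<le>m. pmf p j * pmf (convolution_power p n) (m - j))"
proof -
  have "pmf (map_pmf (\<lambda>x. j + x) (convolution_power p n)) m
      = (if j \<le> m then pmf (convolution_power p n) (m - j) else 0)" for j
  proof (cases "j \<le> m")
    case True
    thus ?thesis
      using pmf_map_inj'[of "\<lambda>x. j + x" "convolution_power p n" "m - j"] by (simp add: inj_on_def)
  next
    case False
    thus ?thesis by (auto simp: pmf_eq_0_set_pmf)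
  qed
  hence "pmf (convolution_power p (Suc n)) m
      = (\<integral>j. (if j \<le> m then pmf (convolution_power p n) (m - j) else 0) \<partial>measure_pmf p)"
    by (simp add: pmf_bind)
  also have "\<dots> = (\<Sum>j\<le>m. pmf p j * pmf (convolution_power p n) (m - j))"
    by (subst integral_measure_pmf[where A = "{..m}"]) (auto split: if_splits)
  finally show ?thesis .
qed

text \<open>The events that the \<open>i\<close>-th summand is \<open>m - k\<close> and the others add up to \<open>k \<le> s\<close> are
disjoint for different \<open>i\<close>, since \<open>m - k > s\<close>. The induction splits on the value \<open>j\<close> of
the new summand: for \<open>j \<le> s\<close> the large summand is among the others and the induction hypothesis
applies with \<open>m - j\<close> and \<open>s - j\<close>; for \<open>j \<ge> m - s\<close> the new summand is itself the large one.\<close>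

lemma convolution_power_one_big_jump:
  fixes p :: "nat pmf"
  assumes "2 * s < m"
  shows "real (Suc n) * (\<Sum>k\<le>s. pmf (convolution_power p n) k * pmf p (m - k))
           \<le> pmf (convolution_power p (Suc n)) m"
  using assms
proof (induction n arbitrary: m s)
  case 0
  have "(\<Sum>k\<le>s. pmf (convolution_power p 0) k * pmf p (m - k))
      = (\<Sum>k\<le>s. if k = 0 then pmf p m else 0)"
    by (intro sum.cong) (auto simp: pmf_return)
  also have "\<dots> = pmf p m" by simp
  also have "\<dots> = pmf (convolution_power p (Suc 0)) m"
    by (simp add: bind_return_pmf')
  finally show ?case by simp
next
  case (Suc n)
  let ?t = "\<lambda>n. pmf (convolution_power p n)"
  have "real (Suc n) * (\<Sum>l\<le>s. ?t (Suc n) l * pmf p (m - l))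
      = real (Suc n) * (\<Sum>l\<le>s. \<Sum>j\<le>l. pmf p j * ?t n (l - j) * pmf p (m - l))"
    by (simp only: pmf_convolution_power_Suc_nat sum_distrib_right)
  also have "(\<Sum>l\<le>s. \<Sum>j\<le>l. pmf p j * ?t n (l - j) * pmf p (m - l))
      = (\<Sum>(l, j)\<in>Sigma {..s} (\<lambda>l. {..l}). pmf p j * ?t n (l - j) * pmf p (m - l))"
    by (rule sum.Sigma) auto
  also have "\<dots> = (\<Sum>(j, k)\<in>Sigma {..s} (\<lambda>j. {..s - j}). pmf p j * ?t n k * pmf p (m - j - k))"
    by (rule sum.reindex_bij_witness[where i = "\<lambda>(j, k). (j + k, j)" and j = "\<lambda>(l, j). (j, l - j)"]) auto
  also have "\<dots> = (\<Sum>j\<le>s. \<Sum>k\<le>s - j. pmf p j * ?t n k * pmf p (m - j - k))"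
    by (rule sum.Sigma[symmetric]) auto
  also have "real (Suc n) * \<dots> = (\<Sum>j\<le>s. pmf p j * (real (Suc n) * (\<Sum>k\<le>s - j. ?t n k * pmf p (m - j - k))))"
    by (simp only: sum_distrib_left mult_ac)
  also have "\<dots> \<le> (\<Sum>j\<le>s. pmf p j * ?t (Suc n) (m - j))"
    using Suc.prems by (intro sum_mono mult_left_mono Suc.IH) auto
  finally have small: "real (Suc n) * (\<Sum>l\<le>s. ?t (Suc n) l * pmf p (m - l))
      \<le> (\<Sum>j\<le>s. pmf p j * ?t (Suc n) (m - j))" .
  have "(\<Sum>k\<le>s. ?t (Suc n) k * pmf p (m - k)) = (\<Sum>j\<in>{m - s..m}. pmf p j * ?t (Suc n) (m - j))"
    using Suc.prems
    by (intro sum.reindex_bij_witness[where i = "\<lambda>j. m - j" and j = "\<lambda>k. m - k"]) (auto simp del: convolution_power.simps)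
  hence "real (Suc (Suc n)) * (\<Sum>k\<le>s. ?t (Suc n) k * pmf p (m - k))
      \<le> (\<Sum>j\<le>s. pmf p j * ?t (Suc n) (m - j)) + (\<Sum>j\<in>{m - s..m}. pmf p j * ?t (Suc n) (m - j))"
    using small by (simp add: algebra_simps del: convolution_power.simps)
  also have "\<dots> = (\<Sum>j\<in>{..s} \<union> {m - s..m}. pmf p j * ?t (Suc n) (m - j))"
    using Suc.prems by (intro sum.union_disjoint[symmetric]) auto
  also have "\<dots> \<le> (\<Sum>j\<le>m. pmf p j * ?t (Suc n) (m - j))"
    using Suc.prems by (intro sum_mono2) auto
  also have "\<dots> = ?t (Suc (Suc n)) m"
    by (rule pmf_convolution_power_Suc_nat[symmetric])
  finally show ?case .
qed

text \<open>The smallness condition on \<open>n \<phi> (1 / s)\<close> keeps the sum of all but one increment below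
\<open>s\<close> with probability at least one half, and monotonicity of the weights bounds the
probability of every jump size occurring here by that of the largest one, \<open>H s\<close>.\<close>

lemma subordinator_pmf_lower_bound:
  assumes "complete_bernstein \<phi> \<mu>" and "\<phi> 0 = 0" and "\<phi> 1 = 1" and "scaling_condition \<phi>"
    and "H \<ge> (1::nat)"
  obtains c where "c > 0"
    and "\<And>n s m. n \<ge> 1 \<Longrightarrow> s \<ge> 1 \<Longrightarrow> 4 * real n * \<phi> (1 / real s) \<le> 1 \<Longrightarrow> 2 * s < m \<Longrightarrow> m \<le> H * s \<Longrightarrow>
           c * (real n * \<phi> (1 / real s) / real s) \<le> pmf (convolution_power (increment_pmf \<mu>) n) m"
proof -
  obtain c1 c2 \<alpha>1 \<alpha>2 where c: "c1 > 0" "c2 > 0" "\<alpha>1 > 0" "\<alpha>2 < 1"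
    and low: "\<And>r R. 0 < r \<Longrightarrow> r \<le> R \<Longrightarrow> R \<le> 1 \<Longrightarrow> c1 * (R / r) powr \<alpha>1 * \<phi> r \<le> \<phi> R"
    and up: "\<And>r R. 0 < r \<Longrightarrow> r \<le> R \<Longrightarrow> R \<le> 1 \<Longrightarrow> \<phi> R \<le> c2 * (R / r) powr \<alpha>2 * \<phi> r"
    using bernstein_scaling[OF assms(1-4)] by metis
  obtain c0 where c0: "c0 > 0" "\<And>N. N \<ge> 1 \<Longrightarrow> pmf (increment_pmf \<mu>) N \<ge> c0 * \<phi> (1 / real N) / real N"
    using increment_pmf_lower_bound[OF assms(1-4)] by metis
  let ?t = "\<lambda>n. pmf (convolution_power (increment_pmf \<mu>) n)"
  \<comment> \<open>By the upper scaling bound, \<open>\<phi> (1 / s) \<le> K \<phi> (1 / (H s))\<close>.\<close>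
  define K where "K = c2 * real H powr \<alpha>2"
  have K: "K > 0" using c assms(5) by (simp add: K_def)
  define c where "c = c0 / (2 * K * real H)"
  have "c * (real n * \<phi> (1 / real s) / real s) \<le> ?t n m"
    if n: "n \<ge> 1" and s: "s \<ge> 1" and small: "4 * real n * \<phi> (1 / real s) \<le> 1"
      and m: "2 * s < m" "m \<le> H * s" for n s m
  proof -
    obtain n' where n': "n = Suc n'" using n by (cases n) auto
    have phi0: "\<phi> (1 / real s) \<ge> 0" using complete_bernstein_nonneg[OF assms(1)] by simp
    have "1 / 2 \<le> 1 - 2 * real n' * \<phi> (1 / real s)"
      using small phi0 by (simp add: n' algebra_simps)
    also have "\<dots> \<le> measure (measure_pmf (convolution_power (increment_pmf \<mu>) n')) {..s}"
      by (rule subordinator_bounded[OF assms(1,3) s])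
    also have "\<dots> = (\<Sum>k\<le>s. ?t n' k)" by (simp add: measure_measure_pmf_finite)
    finally have half: "1 / 2 \<le> (\<Sum>k\<le>s. ?t n' k)" .
    define b where "b = c0 * \<phi> (1 / real s) / (K * real H * real s)"
    have Hs: "H * s \<ge> 1" "m \<ge> 1" using m s assms(5) by auto
    have "b \<le> c0 * \<phi> (1 / real (H * s)) / real (H * s)"
    proof -
      have "\<phi> (1 / real s) \<le> K * \<phi> (1 / real (H * s))"
        using up[of "1 / real (H * s)" "1 / real s"] s assms(5) by (simp add: K_def field_simps)
      hence "c0 * \<phi> (1 / real s) / (K * real H * real s) \<le> c0 * (K * \<phi> (1 / real (H * s))) / (K * real H * real s)"
        using c0 K by (intro divide_right_mono mult_left_mono) auto
      thus ?thesis using K by (simp add: b_def mult_ac)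
    qed
    also have "\<dots> \<le> pmf (increment_pmf \<mu>) (H * s)" by (rule c0(2)) (use Hs in auto)
    finally have b: "b \<le> pmf (increment_pmf \<mu>) (H * s)" .
    have b': "b \<le> pmf (increment_pmf \<mu>) (m - k)" if "k \<le> s" for k
      by (rule order.trans[OF b increment_pmf_decreasing[OF assms(1,3)]]) (use that m in auto)
    have "b \<ge> 0" using c0 K phi0 by (simp add: b_def)
    have "c * (real n * \<phi> (1 / real s) / real s) = real n * (1 / 2 * b)"
      using K assms(5) s by (simp add: c_def b_def field_simps)
    also have "\<dots> \<le> real n * ((\<Sum>k\<le>s. ?t n' k) * b)"
      using half \<open>b \<ge> 0\<close> by (intro mult_left_mono mult_right_mono) auto
    also have "\<dots> \<le> real n * (\<Sum>k\<le>s. ?t n' k * pmf (increment_pmf \<mu>) (m - k))"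
      unfolding sum_distrib_right using b' by (intro mult_left_mono sum_mono) auto
    also have "\<dots> \<le> ?t n m"
      unfolding n' by (rule convolution_power_one_big_jump) (use m in auto)
    finally show ?thesis .
  qed
  moreover have "c > 0" using c0 K assms(5) by (simp add: c_def)
  ultimately show ?thesis by (intro that)
qed

section \<open>One step of the simple random walk\<close>

abbreviation walk_pmf :: "nat \<Rightarrow> (int ^ 'd::finite) pmf" where
  "walk_pmf \<equiv> convolution_power step_pmf"

lemma axis_neq_minus_axis: "axis i (1::int) \<noteq> - axis j 1"
proof
  assume "axis i (1::int) = - axis j 1"
  hence "axis i (1::int) $ i = (- axis j 1) $ i" by simp
  thus False by (auto simp: axis_def split: if_splits)
qed

lemma expectation_step_pmf:
  fixes f :: "int ^ 'd::finite \<Rightarrow> real"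
  shows "measure_pmf.expectation step_pmf f
    = (\<Sum>i\<in>UNIV. f (axis i 1) + f (- axis i 1)) / (2 * real CARD('d))"
proof -
  let ?P = "range (\<lambda>i::'d. axis i (1::int))" and ?N = "range (\<lambda>i::'d. - axis i (1::int))"
  have inj: "inj (\<lambda>i::'d. axis i (1::int))" "inj (\<lambda>i::'d. - axis i (1::int))"
    by (auto simp: inj_def axis_eq_axis)
  have disj: "?P \<inter> ?N = {}" using axis_neq_minus_axis by auto
  have card: "card (?P \<union> ?N) = 2 * CARD('d)"
    by (subst card_Un_disjoint) (use disj inj in \<open>auto simp: card_image\<close>)
  have "measure_pmf.expectation step_pmf f = sum f (?P \<union> ?N) / card (?P \<union> ?N)"
    unfolding step_pmf_def by (rule integral_pmf_of_set) auto
  also have "sum f (?P \<union> ?N) = sum f ?P + sum f ?N"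
    by (rule sum.union_disjoint) (use disj in auto)
  also have "\<dots> = (\<Sum>i\<in>UNIV. f (axis i 1) + f (- axis i 1))"
    using inj by (simp add: sum.reindex sum.distrib)
  finally show ?thesis by (simp add: card)
qed

lemma pmf_walk_Suc:
  fixes z :: "int ^ 'd::finite"
  shows "pmf (walk_pmf (Suc m)) z
    = (\<Sum>i\<in>UNIV. pmf (walk_pmf m) (z - axis i 1) + pmf (walk_pmf m) (z + axis i 1)) / (2 * real CARD('d))"
proof -
  have "pmf (map_pmf (\<lambda>x. s + x) (walk_pmf m)) z = pmf (walk_pmf m) (z - s)" for s
    using pmf_map_inj'[of "\<lambda>x. s + x" "walk_pmf m" "z - s"] by (simp add: inj_def)
  thus ?thesis by (simp add: pmf_bind expectation_step_pmf)
qed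

lemma finite_set_walk_pmf: "finite (set_pmf (walk_pmf m :: (int ^ 'd::finite) pmf))"
  by (induction m) (auto simp: step_pmf_def)

lemma integrable_walk_pmf [simp]:
  fixes f :: "int ^ 'd::finite \<Rightarrow> real"
  shows "integrable (measure_pmf (walk_pmf m)) f"
  by (rule integrable_measure_pmf_finite[OF finite_set_walk_pmf])

lemma expectation_walk_Suc:
  fixes f :: "int ^ 'd::finite \<Rightarrow> real"
  shows "measure_pmf.expectation (walk_pmf (Suc m)) f
    = (\<Sum>i\<in>UNIV. measure_pmf.expectation (walk_pmf m) (\<lambda>x. f (x + axis i 1) + f (x - axis i 1)))
        / (2 * real CARD('d))"
proof -
  have "measure_pmf.expectation (walk_pmf (Suc m)) f
    = measure_pmf.expectation step_pmf (\<lambda>s. measure_pmf.expectation (walk_pmf m) (\<lambda>x. f (s + x)))"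
  proof -
    have fin: "finite (set_pmf (step_pmf :: (int ^ 'd) pmf))" by (simp add: step_pmf_def)
    have "measure_pmf.expectation (walk_pmf (Suc m)) f
      = (\<Sum>s\<in>set_pmf step_pmf. pmf step_pmf s *\<^sub>R
          measure_pmf.expectation (map_pmf (\<lambda>x. s + x) (walk_pmf m)) f)"
      unfolding convolution_power.simps
      by (rule pmf_expectation_bind) (use fin finite_set_walk_pmf[of m] in auto)
    also have "\<dots> = (\<Sum>s\<in>set_pmf step_pmf. pmf step_pmf s *\<^sub>R
          measure_pmf.expectation (walk_pmf m) (\<lambda>x. f (s + x)))"
      by simp
    also have "\<dots> = measure_pmf.expectation step_pmf (\<lambda>s. measure_pmf.expectation (walk_pmf m) (\<lambda>x. f (s + x)))"
      by (rule integral_measure_pmf[symmetric]) (use fin in auto)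
    finally show ?thesis .
  qed
  thus ?thesis by (simp add: expectation_step_pmf add.commute)
qed

section \<open>Reflection symmetry and unimodality of the simple random walk\<close>

text \<open>For \<open>\<sigma>\<close> with values \<open>\<plusminus>1\<close>, a composition of reflections in coordinate hyperplanes.\<close>

definition coordinate_signs :: "('d \<Rightarrow> int) \<Rightarrow> int ^ 'd::finite \<Rightarrow> int ^ 'd" where
  "coordinate_signs \<sigma> z = (\<chi> i. \<sigma> i * z $ i)"

lemma pmf_walk_coordinate_signs:
  fixes z :: "int ^ 'd::finite"
  assumes "\<And>i. \<sigma> i \<in> {1, -1}"
  shows "pmf (walk_pmf m) (coordinate_signs \<sigma> z) = pmf (walk_pmf m) z"
proof (induction m arbitrary: z)
  case 0
  have "\<sigma> i \<noteq> 0" for i using assms[of i] by auto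
  hence "coordinate_signs \<sigma> z = 0 \<longleftrightarrow> z = 0"
    by (auto simp: coordinate_signs_def vec_eq_iff)
  thus ?case by (auto simp: pmf_return)
next
  case (Suc m)
  have "pmf (walk_pmf m) (coordinate_signs \<sigma> z - axis i 1) + pmf (walk_pmf m) (coordinate_signs \<sigma> z + axis i 1)
    = pmf (walk_pmf m) (z - axis i 1) + pmf (walk_pmf m) (z + axis i 1)" for i
  proof -
    have "coordinate_signs \<sigma> z - axis i 1 = coordinate_signs \<sigma> (z - axis i (\<sigma> i))"
      "coordinate_signs \<sigma> z + axis i 1 = coordinate_signs \<sigma> (z + axis i (\<sigma> i))"
      using assms[of i] by (auto simp: coordinate_signs_def vec_eq_iff axis_def algebra_simps)
    moreover have "axis i (-1) = - axis i (1::int)" by (simp add: vec_eq_iff axis_def)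
    ultimately show ?thesis using assms[of i] by (auto simp: Suc.IH)
  qed
  thus ?case unfolding pmf_walk_Suc by simp
qed

lemma map_pmf_coordinate_signs:
  assumes "\<And>i. \<sigma> i \<in> {1, -1}"
  shows "map_pmf (coordinate_signs \<sigma>) (walk_pmf m) = walk_pmf m"
proof (rule pmf_eqI)
  fix z
  have sq: "\<sigma> i * \<sigma> i = 1" for i using assms[of i] by auto
  hence inv: "coordinate_signs \<sigma> (coordinate_signs \<sigma> x) = x" for x
    by (simp add: coordinate_signs_def vec_eq_iff flip: mult.assoc)
  have "inj (coordinate_signs \<sigma>)" by (rule inj_on_inverseI[where g = "coordinate_signs \<sigma>"]) (rule inv)
  from pmf_map_inj'[OF this, of "walk_pmf m" "coordinate_signs \<sigma> z"]
  show "pmf (map_pmf (coordinate_signs \<sigma>) (walk_pmf m)) z = pmf (walk_pmf m) z"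
    using pmf_walk_coordinate_signs[OF assms] by (simp add: inv)
qed

lemma pmf_walk_abs:
  "pmf (walk_pmf m) (\<chi> i. \<bar>z $ i\<bar>) = pmf (walk_pmf m) (z :: int ^ 'd::finite)"
proof -
  have "(\<chi> i. \<bar>z $ i\<bar>) = coordinate_signs (\<lambda>i. if z $ i < 0 then -1 else 1) z"
    by (simp add: coordinate_signs_def vec_eq_iff)
  thus ?thesis by (simp add: pmf_walk_coordinate_signs)
qed

text \<open>A form of the reflection principle, by induction on the time. Neighbours in the other directions are
covered by the induction hypothesis. In direction \<open>i\<close> the two points share the neighbour
\<open>z + e\<^sub>i\<close>, which leaves \<open>z + 3 e\<^sub>i\<close> to be compared with \<open>z - e\<^sub>i\<close>: this takes two
applications of the induction hypothesis if \<open>z $ i \<ge> 0\<close>, and the two values are equal by reflection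
if \<open>z $ i = -1\<close>.\<close>

lemma pmf_walk_unimodal:
  fixes z :: "int ^ 'd::finite"
  assumes "z $ i \<ge> - 1"
  shows "pmf (walk_pmf m) (z + axis i 2) \<le> pmf (walk_pmf m) z"
  using assms
proof (induction m arbitrary: z)
  case 0
  have "z + axis i 2 \<noteq> 0"
  proof
    assume "z + axis i 2 = 0"
    hence "(z + axis i 2) $ i = 0" by simp
    thus False using 0 by simp
  qed
  thus ?case by (simp add: pmf_return)
next
  case (Suc m)
  let ?q = "pmf (walk_pmf m)"
  have "?q (z + axis i 2 - axis j 1) + ?q (z + axis i 2 + axis j 1) \<le> ?q (z - axis j 1) + ?q (z + axis j 1)" for j
  proof (cases "j = i")
    case False
    have "?q ((z - axis j 1) + axis i 2) \<le> ?q (z - axis j 1)" "?q ((z + axis j 1) + axis i 2) \<le> ?q (z + axis j 1)"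
      using Suc.prems False by (intro Suc.IH; simp add: axis_def)+
    thus ?thesis by (simp add: algebra_simps)
  next
    case True
    have "?q (z + axis i 3) \<le> ?q (z - axis i 1)"
    proof (cases "z $ i = -1")
      case True
      have "z + axis i 3 = coordinate_signs (\<lambda>j. if j = i then -1 else 1) (z - axis i 1)"
        using True by (auto simp: coordinate_signs_def vec_eq_iff axis_def)
      thus ?thesis by (simp add: pmf_walk_coordinate_signs)
    next
      case False
      hence "?q ((z + axis i 1) + axis i 2) \<le> ?q (z + axis i 1)" "?q ((z - axis i 1) + axis i 2) \<le> ?q (z - axis i 1)"
        using Suc.prems by (intro Suc.IH; simp)+
      moreover have "(z + axis i 1) + axis i 2 = z + axis i 3" "(z - axis i 1) + axis i 2 = z + axis i 1"
        by (auto simp: vec_eq_iff axis_def)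
      ultimately show ?thesis by simp
    qed
    moreover have eq: "z + axis i 2 - axis i 1 = z + axis i 1" "z + axis i 2 + axis i 1 = z + axis i 3"
      by (auto simp: vec_eq_iff axis_def)
    ultimately show ?thesis unfolding True eq by linarith
  qed
  thus ?case unfolding pmf_walk_Suc by (intro divide_right_mono sum_mono) auto
qed

lemma pmf_walk_antimono:
  fixes y z :: "int ^ 'd::finite"
  assumes "\<And>i. 0 \<le> z $ i" "\<And>i. z $ i \<le> y $ i" "\<And>i. even (y $ i - z $ i)"
  shows "pmf (walk_pmf m) y \<le> pmf (walk_pmf m) z"
proof -
  have one: "pmf (walk_pmf m) (w + axis i (2 * int k)) \<le> pmf (walk_pmf m) w" if "w $ i \<ge> 0" for w :: "int ^ 'd" and i k
  proof (induction k)
    case 0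
    have "w + axis i (2 * int 0) = w" by (simp add: vec_eq_iff axis_def)
    thus ?case by (simp only: order_refl)
  next
    case (Suc k)
    have "w + axis i (2 * int (Suc k)) = (w + axis i (2 * int k)) + axis i 2"
      by (simp add: vec_eq_iff axis_def)
    also have "pmf (walk_pmf m) \<dots> \<le> pmf (walk_pmf m) (w + axis i (2 * int k))"
      using that by (intro pmf_walk_unimodal) simp
    finally show ?case using Suc by simp
  qed
  have "pmf (walk_pmf m) (\<chi> i. if i \<in> I then y $ i else z $ i) \<le> pmf (walk_pmf m) z" if "finite I" for I
    using that
  proof (induction I rule: finite_induct)
    case (insert j I)
    obtain k where k: "y $ j - z $ j = 2 * int k"
      using assms(2,3)[of j] by (metis dvdE even_two_times_div_two diff_ge_0_iff_ge zero_le_imp_eq_int pos_imp_zdiv_nonneg_iff zero_less_numeral)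
    have "(\<chi> i. if i \<in> insert j I then y $ i else z $ i) = (\<chi> i. if i \<in> I then y $ i else z $ i) + axis j (2 * int k)"
      using k insert(2) by (auto simp: vec_eq_iff axis_def)
    also have "pmf (walk_pmf m) \<dots> \<le> pmf (walk_pmf m) (\<chi> i. if i \<in> I then y $ i else z $ i)"
      using assms(1) insert(2) by (intro one) simp
    finally show ?case using insert.IH by simp
  qed (simp add: vec_nth_inverse)
  from this[of UNIV] show ?thesis by (simp add: vec_nth_inverse)
qed

text \<open>Following the prescribed extra steps \<open>- e\<^sub>i\<close>, \<open>i \<in> I\<close>, is one way to reach the shifted point. This
corrects parities at the cost of a bounded factor.\<close>

lemma pmf_walk_step_lower_bound:
  fixes y :: "int ^ 'd::finite"
  assumes "finite I"
  shows "pmf (walk_pmf m) y \<le> (2 * real CARD('d)) ^ card I * pmf (walk_pmf (m + card I)) (y - (\<Sum>i\<in>I. axis i 1))"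
  using assms
proof (induction I rule: finite_induct)
  case (insert j I)
  let ?y = "y - (\<Sum>i\<in>I. axis i 1)"
  let ?q = "pmf (walk_pmf (m + card I))"
  have "?q ?y \<le> ?q (?y - axis j 1 - axis j 1) + ?q (?y - axis j 1 + axis j 1)" by simp
  also have "\<dots> \<le> (\<Sum>i\<in>UNIV. ?q (?y - axis j 1 - axis i 1) + ?q (?y - axis j 1 + axis i 1))"
    by (rule member_le_sum) auto
  also have "\<dots> = (2 * real CARD('d)) * pmf (walk_pmf (Suc (m + card I))) (?y - axis j 1)"
    unfolding pmf_walk_Suc by simp
  finally have step: "?q ?y \<le> (2 * real CARD('d)) * pmf (walk_pmf (Suc (m + card I))) (?y - axis j 1)" .
  have "pmf (walk_pmf m) y \<le> (2 * real CARD('d)) ^ card I * ?q ?y" by (rule insert.IH)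
  also have "\<dots> \<le> (2 * real CARD('d)) ^ card I * ((2 * real CARD('d)) * pmf (walk_pmf (Suc (m + card I))) (?y - axis j 1))"
    using step by (rule mult_left_mono) simp
  also have "\<dots> = (2 * real CARD('d)) ^ card (insert j I)
      * pmf (walk_pmf (m + card (insert j I))) (y - (\<Sum>i\<in>insert j I. axis i 1))"
    using insert by (simp add: algebra_simps del: convolution_power.simps)
  finally show ?case .
qed simp

section \<open>Diffusive spreading\<close>

lemma walk_second_moment:
  "measure_pmf.expectation (walk_pmf m) (\<lambda>x :: int ^ 'd::finite. (real_of_int (x $ k))\<^sup>2) = real m / real CARD('d)"
proof (induction m)
  case (Suc m)
  have "(real_of_int ((x + axis i 1) $ k))\<^sup>2 + (real_of_int ((x - axis i 1) $ k))\<^sup>2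
    = 2 * (real_of_int (x $ k))\<^sup>2 + (if i = k then 2 else 0)" for x :: "int ^ 'd" and i
    by (simp add: axis_def power2_eq_square algebra_simps)
  moreover have "measure_pmf.expectation (walk_pmf m) (\<lambda>x :: int ^ 'd. 2 * (real_of_int (x $ k))\<^sup>2 + (if i = k then 2 else 0))
    = 2 * (real m / real CARD('d)) + (if i = k then 2 else 0)" for i
    by (simp add: Suc.IH)
  ultimately have "measure_pmf.expectation (walk_pmf (Suc m)) (\<lambda>x :: int ^ 'd. (real_of_int (x $ k))\<^sup>2)
    = (\<Sum>i\<in>(UNIV::'d set). 2 * (real m / real CARD('d)) + (if i = k then 2 else 0)) / (2 * real CARD('d))"
    by (simp only: expectation_walk_Suc)
  also have "\<dots> = real (Suc m) / real CARD('d)"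
    by (simp add: sum.distrib add_divide_distrib)
  finally show ?case .
qed simp

lemma walk_fourth_moment:
  "measure_pmf.expectation (walk_pmf m) (\<lambda>x :: int ^ 'd::finite. (real_of_int (x $ k)) ^ 4)
     = 3 * real m * (real m - 1) / (real CARD('d))\<^sup>2 + real m / real CARD('d)"
proof (induction m)
  case (Suc m)
  have "(real_of_int ((x + axis i 1) $ k)) ^ 4 + (real_of_int ((x - axis i 1) $ k)) ^ 4
    = 2 * (real_of_int (x $ k)) ^ 4 + (if i = k then 12 * (real_of_int (x $ k))\<^sup>2 + 2 else 0)" for x :: "int ^ 'd" and i
    by (simp add: axis_def power2_eq_square power4_eq_xxxx algebra_simps)
  moreover have "measure_pmf.expectation (walk_pmf m) (\<lambda>x :: int ^ 'd. 2 * (real_of_int (x $ k)) ^ 4 + (if i = k then 12 * (real_of_int (x $ k))\<^sup>2 + 2 else 0))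
    = 2 * (3 * real m * (real m - 1) / (real CARD('d))\<^sup>2 + real m / real CARD('d)) + (if i = k then 12 * (real m / real CARD('d)) + 2 else 0)" for i
    by (simp add: Suc.IH walk_second_moment)
  ultimately have "measure_pmf.expectation (walk_pmf (Suc m)) (\<lambda>x :: int ^ 'd. (real_of_int (x $ k)) ^ 4)
    = (\<Sum>i\<in>(UNIV::'d set). 2 * (3 * real m * (real m - 1) / (real CARD('d))\<^sup>2 + real m / real CARD('d)) + (if i = k then 12 * (real m / real CARD('d)) + 2 else 0)) / (2 * real CARD('d))"
    by (simp only: expectation_walk_Suc)
  also have "\<dots> = (3 * real m * (real m - 1) / (real CARD('d))\<^sup>2 + real m / real CARD('d)) + (6 * (real m / real CARD('d)) + 1) / real CARD('d)"
    by (simp add: sum.distrib add_divide_distrib)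
  also have "\<dots> = 3 * real (Suc m) * (real (Suc m) - 1) / (real CARD('d))\<^sup>2 + real (Suc m) / real CARD('d)"
    by (simp add: field_simps power2_eq_square)
  finally show ?case .
qed simp

text \<open>A Paley-Zygmund argument with a single test function. With \<open>t = x\<^sub>i\<^sup>2\<close>, the quadratic
\<open>(t - k / 4) (8 k - t)\<close> is nonpositive for \<open>t < k / 4\<close>, at most \<open>16 k\<^sup>2\<close> throughout, and has mean at least
\<open>9 k\<^sup>2 / 4\<close> since \<open>E t = k\<close> and \<open>E t\<^sup>2 \<le> 4 k\<^sup>2\<close>. The upper bounds on all
coordinates cost at most \<open>1 / 16\<close> by Chebyshev's inequality.\<close>

lemma walk_spread:
  fixes i :: "'d::finite"
  assumes "k \<ge> (1::nat)"
  shows "1 / 16 \<le> measure (measure_pmf (walk_pmf (CARD('d) * k)))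
    {x. real k / 4 \<le> (real_of_int (x $ i))\<^sup>2 \<and> (\<forall>j. (real_of_int (x $ j))\<^sup>2 \<le> 16 * real CARD('d) * real k)}"
    (is "_ \<le> measure ?W ?A")
proof -
  let ?d = "real CARD('d)" and ?k = "real k"
  let ?E = "measure_pmf.expectation (walk_pmf (CARD('d) * k) :: (int ^ 'd) pmf)"
  define t where "t j x = (real_of_int (x $ j))\<^sup>2" for j and x :: "int ^ 'd"
  have k: "?k > 0" using assms by simp
  have t2: "?E (t j) = ?k" for j
    unfolding t_def by (simp add: walk_second_moment)
  have "?E (\<lambda>x. t j x ^ 2) = 3 * ?k * (?d * ?k - 1) / ?d + ?k" for j
    unfolding t_def power_mult[symmetric] by (simp add: walk_fourth_moment power2_eq_square)
  also have "3 * ?k * (?d * ?k - 1) / ?d + ?k \<le> 4 * ?k\<^sup>2"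
  proof -
    have "3 * ?k * (?d * ?k - 1) / ?d = 3 * ?k * ?k - 3 * ?k / ?d" by (simp add: field_simps)
    also have "\<dots> \<le> 3 * ?k * ?k" by simp
    finally have "3 * ?k * (?d * ?k - 1) / ?d + ?k * 1 \<le> 3 * ?k * ?k + ?k * ?k"
      using assms by (intro add_mono mult_left_mono) auto
    thus ?thesis by (simp add: power2_eq_square)
  qed
  finally have t4: "?E (\<lambda>x. t j x ^ 2) \<le> 4 * ?k\<^sup>2" for j .
  have pw: "(t i x - ?k / 4) * (8 * ?k - t i x) / (16 * ?k\<^sup>2) - (\<Sum>j\<in>UNIV. t j x / (16 * ?d * ?k)) \<le> indicator ?A x" for x
  proof -
    have ind: "(0::real) \<le> indicator ?A x" by simp
    have sum_nonneg: "0 \<le> (\<Sum>j\<in>UNIV. t j x / (16 * ?d * ?k))"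
      by (intro sum_nonneg divide_nonneg_nonneg) (auto simp: t_def)
    have le1: "(t i x - ?k / 4) * (8 * ?k - t i x) \<le> 16 * ?k\<^sup>2"
    proof -
      have "16 * ?k\<^sup>2 - (t i x - ?k / 4) * (8 * ?k - t i x) = (t i x - 33 / 8 * ?k)\<^sup>2 + 63 / 64 * ?k\<^sup>2"
        by (simp add: power2_eq_square field_simps)
      also have "\<dots> \<ge> 0" by simp
      finally show ?thesis by simp
    qed
    hence le1': "(t i x - ?k / 4) * (8 * ?k - t i x) / (16 * ?k\<^sup>2) \<le> 1" using k by (simp add: divide_le_eq)
    consider "x \<in> ?A" | "t i x < ?k / 4" | j where "t j x > 16 * ?d * ?k"
      unfolding t_def mem_Collect_eq using not_le by blast
    thus ?thesis
    proof cases
      case 1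
      thus ?thesis using le1' sum_nonneg by simp
    next
      case 2
      hence "(t i x - ?k / 4) * (8 * ?k - t i x) \<le> 0" using k by (intro mult_nonpos_nonneg) auto
      hence "(t i x - ?k / 4) * (8 * ?k - t i x) / (16 * ?k\<^sup>2) \<le> 0" by (rule divide_nonpos_nonneg) simp
      thus ?thesis using sum_nonneg ind by linarith
    next
      case (3 j)
      have "1 \<le> t j x / (16 * ?d * ?k)" using 3 k by (simp add: le_divide_eq)
      also have "\<dots> \<le> (\<Sum>j\<in>UNIV. t j x / (16 * ?d * ?k))"
        by (rule member_le_sum) (auto simp: t_def)
      finally show ?thesis using le1' ind by linarith
    qed
  qed
  have "1 / 16 \<le> (33 / 4 * ?k * ?k - 2 * ?k\<^sup>2 - 4 * ?k\<^sup>2) / (16 * ?k\<^sup>2) - 1 / 16"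
    using k by (simp add: power2_eq_square field_simps)
  also have "\<dots> \<le> (33 / 4 * ?k * ?E (t i) - 2 * ?k\<^sup>2 - ?E (\<lambda>x. t i x ^ 2)) / (16 * ?k\<^sup>2) - (\<Sum>j\<in>(UNIV::'d set). ?E (t j) / (16 * ?d * ?k))"
    using t4[of i] k by (simp add: t2 divide_right_mono)
  also have "\<dots> = ?E (\<lambda>x. (33 / 4 * ?k * t i x - 2 * ?k\<^sup>2 - t i x ^ 2) / (16 * ?k\<^sup>2) - (\<Sum>j\<in>UNIV. t j x / (16 * ?d * ?k)))"
    by (simp add: Bochner_Integration.integral_sum)
  also have "\<dots> = ?E (\<lambda>x. (t i x - ?k / 4) * (8 * ?k - t i x) / (16 * ?k\<^sup>2) - (\<Sum>j\<in>UNIV. t j x / (16 * ?d * ?k)))"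
    by (simp add: power2_eq_square algebra_simps)
  also have "\<dots> \<le> ?E (indicator ?A)"
    by (rule integral_mono) (use pw in auto)
  also have "\<dots> = measure ?W ?A" by simp
  finally show ?thesis .
qed

text \<open>Reflections permute the orthants and preserve the law, so each of the \<open>2\<^sup>d\<close> orthants carries an
equal share.\<close>

lemma walk_spread_orthant:
  fixes i :: "'d::finite"
  assumes "k \<ge> (1::nat)"
  shows "1 / (16 * 2 ^ CARD('d)) \<le> measure (measure_pmf (walk_pmf (CARD('d) * k)))
    {x. sqrt (real k) / 2 \<le> real_of_int (x $ i) \<and>
        (\<forall>j. 0 \<le> x $ j \<and> real_of_int (x $ j) \<le> 4 * sqrt (real CARD('d) * real k))}"
    (is "_ \<le> measure ?W ?B")
proof -
  let ?A = "{x. real k / 4 \<le> (real_of_int (x $ i))\<^sup>2 \<and>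
    (\<forall>j. (real_of_int (x $ j))\<^sup>2 \<le> 16 * real CARD('d) * real k)}"
  let ?\<Sigma> = "PiE (UNIV :: 'd set) (\<lambda>_. {1, -1 :: int})"
  have fin: "finite ?\<Sigma>" by (intro finite_PiE) auto
  have card: "card ?\<Sigma> = 2 ^ CARD('d)" by (simp add: card_PiE numeral_2_eq_2)
  have B: "x \<in> ?B" if "x \<in> ?A" "\<And>j. 0 \<le> x $ j" for x
  proof -
    have "sqrt (real k / 4) \<le> real_of_int (x $ i)"
      using that by (intro real_le_lsqrt) auto
    moreover have "real_of_int (x $ j) \<le> sqrt (16 * real CARD('d) * real k)" for j
      using that by (intro real_le_rsqrt) auto
    ultimately show ?thesis using that(2) by (auto simp: real_sqrt_divide real_sqrt_mult mult_ac)
  qed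
  have "?A \<subseteq> (\<Union>\<sigma>\<in>?\<Sigma>. coordinate_signs \<sigma> -` ?B)"
  proof
    fix x assume x: "x \<in> ?A"
    define \<sigma> where "\<sigma> = (\<lambda>i. if x $ i < 0 then -1 else 1 :: int)"
    have "coordinate_signs \<sigma> x = (\<chi> i. \<bar>x $ i\<bar>)"
      by (simp add: coordinate_signs_def \<sigma>_def vec_eq_iff)
    moreover have "(\<chi> i. \<bar>x $ i\<bar>) \<in> ?B" using x by (intro B) auto
    ultimately have "x \<in> coordinate_signs \<sigma> -` ?B" by simp
    moreover have "\<sigma> \<in> ?\<Sigma>" by (auto simp: \<sigma>_def split: if_splits)
    ultimately show "x \<in> (\<Union>\<sigma>\<in>?\<Sigma>. coordinate_signs \<sigma> -` ?B)" by blast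
  qed
  hence "measure ?W ?A \<le> measure ?W (\<Union>\<sigma>\<in>?\<Sigma>. coordinate_signs \<sigma> -` ?B)"
    by (intro measure_pmf.finite_measure_mono) auto
  also have "\<dots> \<le> (\<Sum>\<sigma>\<in>?\<Sigma>. measure ?W (coordinate_signs \<sigma> -` ?B))"
    by (rule measure_pmf.finite_measure_subadditive_finite) (use fin in auto)
  also have "\<dots> = (\<Sum>\<sigma>\<in>?\<Sigma>. measure ?W ?B)"
  proof (rule sum.cong[OF refl])
    fix \<sigma> assume "\<sigma> \<in> ?\<Sigma>"
    hence "\<sigma> i \<in> {1, -1}" for i by (auto simp: PiE_def)
    hence eq: "map_pmf (coordinate_signs \<sigma>) (walk_pmf (CARD('d) * k)) = walk_pmf (CARD('d) * k)"
      by (rule map_pmf_coordinate_signs)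
    have "measure ?W (coordinate_signs \<sigma> -` ?B)
        = measure (measure_pmf (map_pmf (coordinate_signs \<sigma>) (walk_pmf (CARD('d) * k)))) ?B"
      by (rule measure_map_pmf[symmetric])
    also have "\<dots> = measure ?W ?B" by (simp only: eq)
    finally show "measure ?W (coordinate_signs \<sigma> -` ?B) = measure ?W ?B" .
  qed
  also have "\<dots> = 2 ^ CARD('d) * measure ?W ?B" by (simp add: card)
  finally have "1 / 16 \<le> 2 ^ CARD('d) * measure ?W ?B"
    using walk_spread[OF assms, of i] by simp
  thus ?thesis by (simp add: field_simps)
qed

text \<open>One phase of \<open>d k\<close> steps is spent on each coordinate: it pushes this coordinate up and, by
\<open>walk_spread_orthant\<close>, does not decrease any other.\<close>

lemma walk_spread_all_coordinates:
  assumes "k \<ge> (1::nat)"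
  shows "(1 / (16 * 2 ^ CARD('d))) ^ CARD('d) \<le> measure (measure_pmf (walk_pmf (CARD('d) * (CARD('d) * k))))
    {x :: int ^ 'd::finite. \<forall>j. 0 \<le> x $ j \<and> sqrt (real k) / 2 \<le> real_of_int (x $ j) \<and>
        real_of_int (x $ j) \<le> real CARD('d) * (4 * sqrt (real CARD('d) * real k))}"
proof -
  define b where "b = 4 * sqrt (real CARD('d) * real k)"
  define C where "C I = {x :: int ^ 'd. (\<forall>j. 0 \<le> x $ j \<and> real_of_int (x $ j) \<le> real (card I) * b) \<and>
    (\<forall>j\<in>I. sqrt (real k) / 2 \<le> real_of_int (x $ j))}" for I
  have "(1 / (16 * 2 ^ CARD('d))) ^ card I \<le> measure (measure_pmf (walk_pmf (card I * (CARD('d) * k)))) (C I)"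
    if "finite I" for I
    using that
  proof (induction I rule: finite_induct)
    case empty
    show ?case by (simp add: C_def indicator_def)
  next
    case (insert i I)
    let ?B = "{x :: int ^ 'd. sqrt (real k) / 2 \<le> real_of_int (x $ i) \<and>
        (\<forall>j. 0 \<le> x $ j \<and> real_of_int (x $ j) \<le> b)}"
    have "(1 / (16 * 2 ^ CARD('d)) :: real) ^ card (insert i I) = 1 / (16 * 2 ^ CARD('d)) * (1 / (16 * 2 ^ CARD('d))) ^ card I"
      using insert by simp
    also have "\<dots> \<le> measure (measure_pmf (walk_pmf (CARD('d) * k))) ?B * measure (measure_pmf (walk_pmf (card I * (CARD('d) * k)))) (C I)"
      by (intro mult_mono insert.IH walk_spread_orthant[OF assms, of i, folded b_def]) auto
    also have "\<dots> \<le> measure (measure_pmf (walk_pmf (CARD('d) * k + card I * (CARD('d) * k)))) (C (insert i I))"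
    proof (rule measure_convolution_power_add)
      fix x y assume xy: "x \<in> ?B" "y \<in> C I"
      have "real_of_int (x $ j) + real_of_int (y $ j) \<le> b + real (card I) * b" for j
        using xy by (intro add_mono) (auto simp: C_def)
      moreover have "sqrt (real k) / 2 \<le> real_of_int (x $ j) + real_of_int (y $ j)" if "j \<in> insert i I" for j
      proof (cases "j = i")
        case True
        have "0 \<le> real_of_int (y $ i)" using xy by (simp add: C_def)
        moreover have "sqrt (real k) / 2 \<le> real_of_int (x $ i)" using xy by simp
        ultimately show ?thesis using True by simp
      next
        case False
        have "0 \<le> real_of_int (x $ j)" using xy by simp
        moreover have "sqrt (real k) / 2 \<le> real_of_int (y $ j)" using xy False that by (simp add: C_def)
        ultimately show ?thesis by simp
      qed
      ultimately show "x + y \<in> C (insert i I)"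
        using xy insert by (auto simp: C_def algebra_simps)
    qed
    finally show ?case using insert by (simp add: algebra_simps)
  qed
  from this[of UNIV] show ?thesis by (simp add: C_def b_def all_conj_distrib conj_ac)
qed

section \<open>Local lower bound for the simple random walk\<close>

lemma card_box_le:
  "finite {x :: int ^ 'd::finite. \<forall>i. x $ i \<in> S}"  "card {x :: int ^ 'd. \<forall>i. x $ i \<in> S} \<le> card S ^ CARD('d)"
  if "finite S"
proof -
  let ?V = "{x :: int ^ 'd. \<forall>i. x $ i \<in> S}"
  have inj: "inj_on vec_nth ?V" by (auto simp: inj_on_def vec_nth_inject)
  have sub: "vec_nth ` ?V \<subseteq> PiE UNIV (\<lambda>_. S)" by auto
  have fin: "finite (PiE (UNIV::'d set) (\<lambda>_. S))" using that by (intro finite_PiE) auto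
  show "finite ?V" using finite_subset[OF sub fin] inj by (rule finite_imageD)
  have "card ?V = card (vec_nth ` ?V)" using inj by (simp add: card_image)
  also have "\<dots> \<le> card (PiE (UNIV::'d set) (\<lambda>_. S))" by (rule card_mono[OF fin sub])
  also have "\<dots> = card S ^ CARD('d)" by (simp add: card_PiE)
  finally show "card ?V \<le> card S ^ CARD('d)" .
qed

text \<open>The sum over \<open>j \<le> d\<close> covers the extra steps that bring a point of the box into the parity class
of \<open>z\<close>; at a single time the probability can be zero by parity.\<close>

lemma walk_local_lower_bound:
  obtains c where "c > 0"
    and "\<And>k (z :: int ^ 'd::finite). k \<ge> (1::nat) \<Longrightarrow> (\<And>i. 2 * (real_of_int \<bar>z $ i\<bar> + 1) \<le> sqrt (real k)) \<Longrightarrow>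
      c / sqrt (real k) ^ CARD('d) \<le> (\<Sum>j\<le>CARD('d). pmf (walk_pmf (CARD('d) * (CARD('d) * k) + j)) z)"
proof -
  let ?d = "real CARD('d)"
  define p0 where "p0 = (1 / (16 * 2 ^ CARD('d)) :: real) ^ CARD('d)"
  define c where "c = p0 / ((2 * ?d) ^ CARD('d) * (5 * ?d ^ 2) ^ CARD('d))"
  have d: "1 \<le> ?d" "1 \<le> 2 * ?d" using zero_less_card_finite[where 'a = 'd] by linarith+
  have main: "c / sqrt (real k) ^ CARD('d) \<le> (\<Sum>j\<le>CARD('d). pmf (walk_pmf (CARD('d) * (CARD('d) * k) + j)) z)"
    if k: "k \<ge> 1" and z: "\<And>i. 2 * (real_of_int \<bar>z $ i\<bar> + 1) \<le> sqrt (real k)" for k and z :: "int ^ 'd"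
  proof -
    let ?m = "CARD('d) * (CARD('d) * k)"
    let ?S = "\<Sum>j\<le>CARD('d). pmf (walk_pmf (?m + j)) z"
    define b where "b = ?d * (4 * sqrt (?d * real k))"
    define Q where "Q = {x :: int ^ 'd. \<forall>j. 0 \<le> x $ j \<and> sqrt (real k) / 2 \<le> real_of_int (x $ j) \<and>
        real_of_int (x $ j) \<le> b}"
    have b0: "b \<ge> 0" by (simp add: b_def)
    have sub: "Q \<subseteq> {x. \<forall>i. x $ i \<in> {0..\<lfloor>b\<rfloor>}}" by (auto simp: Q_def le_floor_iff)
    have finQ: "finite Q" by (rule finite_subset[OF sub card_box_le(1)]) simp
    have "card Q \<le> card {x :: int ^ 'd. \<forall>i. x $ i \<in> {0..\<lfloor>b\<rfloor>}}"
      by (rule card_mono[OF card_box_le(1) sub]) simp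
    also have "\<dots> \<le> card {0..\<lfloor>b\<rfloor>} ^ CARD('d)" by (rule card_box_le(2)) simp
    finally have "real (card Q) \<le> real (card {0..\<lfloor>b\<rfloor>}) ^ CARD('d)" by (simp flip: of_nat_power)
    also have "\<dots> \<le> (5 * ?d ^ 2 * sqrt (real k)) ^ CARD('d)"
    proof (rule power_mono)
      have "real (card {0..\<lfloor>b\<rfloor>}) \<le> b + 1" using b0 by simp
      also have "b \<le> 4 * ?d ^ 2 * sqrt (real k)"
      proof -
        have "sqrt ?d \<le> ?d" using d by (simp add: sqrt_le_D power2_eq_square real_le_lsqrt)
        hence "?d * (sqrt ?d * sqrt (real k)) \<le> ?d * (?d * sqrt (real k))" by (intro mult_left_mono mult_right_mono) auto
        thus ?thesis by (simp add: b_def real_sqrt_mult power2_eq_square)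
      qed
      also have "1 \<le> ?d ^ 2 * sqrt (real k)"
      proof -
        have "1 * 1 \<le> ?d ^ 2 * sqrt (real k)" using d k by (intro mult_mono) (auto intro: one_le_power)
        thus ?thesis by simp
      qed
      finally show "real (card {0..\<lfloor>b\<rfloor>}) \<le> 5 * ?d ^ 2 * sqrt (real k)" by (simp add: mult_ac)
    qed simp
    finally have cardQ: "real (card Q) \<le> (5 * ?d ^ 2 * sqrt (real k)) ^ CARD('d)" .
    have point: "pmf (walk_pmf ?m) y \<le> (2 * ?d) ^ CARD('d) * ?S" if y: "y \<in> Q" for y
    proof -
      \<comment> \<open>Lowering \<open>y\<close> by one in the coordinates of \<open>I\<close> reaches the parity class of \<open>|z|\<close>, and
        stays above \<open>|z|\<close> because \<open>y\<close> exceeds it by at least one.\<close>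
      define I where "I = {i. odd (y $ i - \<bar>z $ i\<bar>)}"
      define y' where "y' = y - (\<Sum>i\<in>I. axis i 1)"
      have y': "y' $ i = (if i \<in> I then y $ i - 1 else y $ i)" for i
        by (simp add: y'_def axis_def if_distrib sum.If_cases cong: if_cong)
      have zy: "\<bar>z $ i\<bar> + 1 \<le> y $ i" for i
      proof -
        have "real_of_int (\<bar>z $ i\<bar> + 1) \<le> sqrt (real k) / 2" using z[of i] by simp
        also have "\<dots> \<le> real_of_int (y $ i)" using y by (simp add: Q_def)
        finally show ?thesis by linarith
      qed
      have cI: "card I \<le> CARD('d)" by (rule card_mono) auto
      have "pmf (walk_pmf ?m) y \<le> (2 * ?d) ^ card I * pmf (walk_pmf (?m + card I)) y'"
        unfolding y'_def by (rule pmf_walk_step_lower_bound) simp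
      also have "pmf (walk_pmf (?m + card I)) y' \<le> pmf (walk_pmf (?m + card I)) (\<chi> i. \<bar>z $ i\<bar>)"
      proof (rule pmf_walk_antimono)
        fix i
        show "(\<chi> i. \<bar>z $ i\<bar>) $ i \<le> y' $ i" using zy[of i] by (simp add: y')
        show "even (y' $ i - (\<chi> i. \<bar>z $ i\<bar>) $ i)" by (auto simp: y' I_def)
      qed simp
      also have "\<dots> = pmf (walk_pmf (?m + card I)) z" by (rule pmf_walk_abs)
      also have "\<dots> \<le> ?S"
        by (rule member_le_sum[of "card I" _ "\<lambda>j. pmf (walk_pmf (?m + j)) z"]) (use cI in auto)
      also have "(2 * ?d) ^ card I * ?S \<le> (2 * ?d) ^ CARD('d) * ?S"
        using d by (intro mult_right_mono power_increasing[OF cI] sum_nonneg) auto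
      finally show ?thesis by simp
    qed
    have "p0 \<le> measure (measure_pmf (walk_pmf ?m)) Q"
      using walk_spread_all_coordinates[OF k, where ?'d = 'd] by (simp only: p0_def Q_def b_def)
    also have "\<dots> = (\<Sum>y\<in>Q. pmf (walk_pmf ?m) y)" by (rule measure_measure_pmf_finite[OF finQ])
    also have "\<dots> \<le> real (card Q) * ((2 * ?d) ^ CARD('d) * ?S)"
      using point by (rule sum_bounded_above)
    also have "\<dots> \<le> (5 * ?d ^ 2 * sqrt (real k)) ^ CARD('d) * ((2 * ?d) ^ CARD('d) * ?S)"
      using d by (intro mult_right_mono[OF cardQ] mult_nonneg_nonneg sum_nonneg) auto
    finally have "p0 \<le> (5 * ?d ^ 2) ^ CARD('d) * sqrt (real k) ^ CARD('d) * ((2 * ?d) ^ CARD('d) * ?S)"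
      by (simp add: power_mult_distrib)
    thus ?thesis using d k by (simp add: c_def field_simps)
  qed
  have "c > 0" using d by (simp add: c_def p0_def)
  thus ?thesis
  proof (rule that)
    fix k :: nat and z :: "int ^ 'd"
    assume *: "k \<ge> 1" "\<And>i. 2 * (real_of_int \<bar>z $ i\<bar> + 1) \<le> sqrt (real k)"
    show "c / sqrt (real k) ^ CARD('d) \<le> (\<Sum>j\<le>CARD('d). pmf (walk_pmf (CARD('d) * (CARD('d) * k) + j)) z)"
      by (rule main[OF *])
  qed
qed

section \<open>Assembling the heat kernel bound\<close>

lemma lattice_norm_component: "real_of_int \<bar>z $ i\<bar> \<le> lattice_norm (z :: int ^ 'd::finite)"
  using component_le_norm_cart[of "\<chi> i. real_of_int (z $ i)" i] by (simp add: lattice_norm_def)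

text \<open>Both branches of the minimum are instances, with \<open>r = 1 / \<phi>\<^sup>-\<^sup>1(1 / n)\<close> and
\<open>r = |x - y|\<^sup>2\<close>. The times used are \<open>d\<^sup>2 (2 k) + j\<close> with \<open>s < k \<le> 2 s\<close> and \<open>j \<le> d\<close>, where \<open>s\<close> is a
large multiple of \<open>r\<close>.\<close>

lemma transition_prob_scale_lower_bound:
  assumes "complete_bernstein \<phi> \<mu>" and "\<phi> 0 = 0" and "\<phi> 1 = 1" and "scaling_condition \<phi>"
  obtains C where "C > 0"
    and "\<And>n r (x :: int ^ 'd::finite) y. n \<ge> (1::nat) \<Longrightarrow> r \<ge> 1 \<Longrightarrow> (lattice_norm (y - x))\<^sup>2 \<le> r \<Longrightarrow>
      real n * \<phi> (1 / r) \<le> 1 \<Longrightarrow> C * (real n * \<phi> (1 / r) / sqrt r ^ CARD('d)) \<le> transition_prob \<mu> n x y"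
proof -
  let ?d = "CARD('d)"
  obtain c1 c2 \<alpha>1 \<alpha>2 where c: "c1 > 0" "c2 > 0" "\<alpha>1 > 0" "\<alpha>2 < 1"
    and low: "\<And>r R. 0 < r \<Longrightarrow> r \<le> R \<Longrightarrow> R \<le> 1 \<Longrightarrow> c1 * (R / r) powr \<alpha>1 * \<phi> r \<le> \<phi> R"
    and up: "\<And>r R. 0 < r \<Longrightarrow> r \<le> R \<Longrightarrow> R \<le> 1 \<Longrightarrow> \<phi> R \<le> c2 * (R / r) powr \<alpha>2 * \<phi> r"
    using bernstein_scaling[OF assms(1-4)] by metis
  \<comment> \<open>A time scale \<open>s \<ge> L r\<close> makes \<open>n \<phi> (1 / s)\<close> at most a quarter, and the factor 8 makes \<open>\<surd>(2 k)\<close>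
    large enough compared with \<open>|y - x| \<le> \<surd>r\<close> for the local bound of the walk.\<close>
  obtain L0 :: nat where L0: "L0 \<ge> 1" "real L0 powr (- \<alpha>1) \<le> c1 / 4"
    using ex_nat_powr_small[of "\<alpha>1" "c1 / 4"] c by auto
  define L where "L = 8 * L0"
  have L: "L \<ge> 8" "real L powr (- \<alpha>1) \<le> c1 / 4"
  proof -
    have "real L powr (- \<alpha>1) \<le> real L0 powr (- \<alpha>1)"
      using L0 c by (intro powr_mono2') (auto simp: L_def)
    thus "real L powr (- \<alpha>1) \<le> c1 / 4" using L0 by simp
  qed (use L0 in \<open>auto simp: L_def\<close>)
  define D where "D = ?d * ?d"
  have d: "?d \<ge> 1" using zero_less_card_finite[where 'a = 'd] by linarith
  have D: "D \<ge> 1" "?d \<le> D" using d by (auto simp: D_def)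
  obtain cT where cT: "cT > 0"
    "\<And>n s m. n \<ge> 1 \<Longrightarrow> s \<ge> 1 \<Longrightarrow> 4 * real n * \<phi> (1 / real s) \<le> 1 \<Longrightarrow> 2 * s < m \<Longrightarrow> m \<le> (5 * D) * s \<Longrightarrow>
       cT * (real n * \<phi> (1 / real s) / real s) \<le> pmf (convolution_power (increment_pmf \<mu>) n) m"
    using subordinator_pmf_lower_bound[OF assms, of "5 * D"] D by auto
  obtain cW where cW: "cW > 0"
    "\<And>k (z :: int ^ 'd). k \<ge> 1 \<Longrightarrow> (\<And>i. 2 * (real_of_int \<bar>z $ i\<bar> + 1) \<le> sqrt (real k)) \<Longrightarrow>
      cW / sqrt (real k) ^ ?d \<le> (\<Sum>j\<le>?d. pmf (walk_pmf (?d * (?d * k) + j)) z)"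
    using walk_local_lower_bound by metis
  define C where "C = cT * cW / (2 * real L * c2 * sqrt (8 * real L) ^ ?d)"
  have C: "C > 0" using cT cW L c by (simp add: C_def)
  have main: "C * (real n * \<phi> (1 / r) / sqrt r ^ ?d) \<le> transition_prob \<mu> n x y"
    if n: "n \<ge> 1" and r: "r \<ge> 1" and z: "(lattice_norm (y - x))\<^sup>2 \<le> r" and phi: "real n * \<phi> (1 / r) \<le> 1"
    for n r and x y :: "int ^ 'd"
  proof -
    define N where "N = nat \<lceil>r\<rceil>"
    have N: "N \<ge> 1" "r \<le> real N" "real N \<le> 2 * r" using r unfolding N_def by linarith+
    define s where "s = L * N"
    have s: "s \<ge> 1" "r \<le> real s" "real s \<le> 2 * real L * r" "8 * N \<le> s"
    proof -
      show "s \<ge> 1" using L N by (simp add: s_def)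
      have "N \<le> s" using L by (simp add: s_def)
      thus "r \<le> real s" using N by simp
      have "real L * real N \<le> real L * (2 * r)" using N by (intro mult_left_mono) auto
      thus "real s \<le> 2 * real L * r" by (simp add: s_def)
      show "8 * N \<le> s" using L by (simp add: s_def)
    qed
    have pos: "\<phi> (1 / real s) \<ge> 0" "\<phi> (1 / r) \<ge> 0" using complete_bernstein_nonneg[OF assms(1)] r by auto
    have small: "4 * real n * \<phi> (1 / real s) \<le> 1"
    proof -
      have "\<phi> (1 / real N) \<le> \<phi> (1 / r)"
        using strict_mono_on_leD[OF complete_bernstein_strict_mono[OF assms(1,3)], of "1 / real N" "1 / r"] r N
        by (auto simp: frac_le)
      have "c1 * \<phi> (1 / real s) \<le> \<phi> (1 / real N) * real L powr (- \<alpha>1)"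
      proof -
        have "1 / real s \<le> 1 / real N" using L N by (intro divide_left_mono) (auto simp: s_def)
        thus ?thesis
          using low[of "1 / real s" "1 / real N"] s N L by (simp add: s_def powr_minus field_simps)
      qed
      also have "\<dots> \<le> \<phi> (1 / r) * (c1 / 4)"
        using \<open>\<phi> (1 / real N) \<le> \<phi> (1 / r)\<close> L pos by (intro mult_mono) auto
      finally have "4 * \<phi> (1 / real s) \<le> \<phi> (1 / r)" using c by simp
      hence "real n * (4 * \<phi> (1 / real s)) \<le> real n * \<phi> (1 / r)" by (intro mult_left_mono) auto
      thus ?thesis using phi by (simp add: mult_ac)
    qed
    let ?t = "\<lambda>m. pmf (convolution_power (increment_pmf \<mu>) n) m"
    let ?w = "\<lambda>m. pmf (walk_pmf m) (y - x)"
    let ?J = "{s<..2 * s} \<times> {..?d}"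
    define f where "f = (\<lambda>(k, j). D * (2 * k) + j)"
    \<comment> \<open>The factor 2 separates the blocks of \<open>d + 1\<close> times that belong to different \<open>k\<close>, as
      \<open>j \<le> d < 2 d\<^sup>2\<close>.\<close>
    have inj: "inj_on f ?J"
    proof (rule inj_onI, clarify)
      fix k j k' j' assume *: "j \<le> ?d" "j' \<le> ?d" "f (k, j) = f (k', j')"
      have "j < D * 2" "j' < D * 2" using * D by auto
      hence "(D * (2 * k) + j) div (D * 2) = k" "(D * (2 * k') + j') div (D * 2) = k'"
        using D by (simp_all add: div_mult_self4 mult.assoc[symmetric])
      thus "k = k' \<and> j = j'" using * by (simp add: f_def)
    qed
    define B where "B = cT * (real n * \<phi> (1 / real s) / real s)"
    have B0: "B \<ge> 0" using cT pos by (simp add: B_def)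
    have tB: "B \<le> ?t (f (k, j))" if "k \<in> {s<..2 * s}" "j \<le> ?d" for k j
      unfolding B_def
    proof (rule cT(2)[OF n s(1) small])
      have "1 * (2 * k) \<le> D * (2 * k)" using D by (intro mult_right_mono) auto
      hence "2 * k \<le> f (k, j)" unfolding f_def prod.case by linarith
      thus "2 * s < f (k, j)" using that by simp
      have "D * (2 * k) \<le> D * (4 * s)" using that by (intro mult_left_mono) auto
      moreover have "j \<le> D * s" using that D s(1) by (metis mult.right_neutral mult_le_mono order_trans)
      ultimately show "f (k, j) \<le> 5 * D * s" unfolding f_def prod.case by linarith
    qed
    have wB: "cW / sqrt (4 * real s) ^ ?d \<le> (\<Sum>j\<le>?d. ?w (f (k, j)))" if k: "k \<in> {s<..2 * s}" for k
    proof -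
      have "2 * (real_of_int \<bar>(y - x) $ i\<bar> + 1) \<le> sqrt (real (2 * k))" for i
      proof -
        have "lattice_norm (y - x) \<le> sqrt r" using z by (intro real_le_rsqrt)
        moreover have "1 \<le> sqrt r" using r by simp
        ultimately have "2 * (real_of_int \<bar>(y - x) $ i\<bar> + 1) \<le> 2 * (sqrt r + sqrt r)"
          using lattice_norm_component[of "y - x" i] by (intro mult_left_mono add_mono) (auto intro: order_trans)
        also have "\<dots> = sqrt (16 * r)" by (simp add: real_sqrt_mult)
        also have "\<dots> \<le> sqrt (real (2 * k))" using k s(4) N by simp
        finally show ?thesis .
      qed
      hence "cW / sqrt (real (2 * k)) ^ ?d \<le> (\<Sum>j\<le>?d. ?w (?d * (?d * (2 * k)) + j))"
        using k by (intro cW(2)) auto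
      moreover have "cW / sqrt (4 * real s) ^ ?d \<le> cW / sqrt (real (2 * k)) ^ ?d"
        using k cW(1) by (intro divide_left_mono power_mono mult_pos_pos) auto
      ultimately show ?thesis by (simp add: f_def D_def mult.assoc)
    qed
    have phi_r: "\<phi> (1 / r) \<le> c2 * (2 * real L) * \<phi> (1 / real s)"
    proof -
      have "1 / real s \<le> 1 / r" using s r by (intro divide_left_mono) auto
      hence "\<phi> (1 / r) \<le> c2 * (real s / r) powr \<alpha>2 * \<phi> (1 / real s)"
        using up[of "1 / real s" "1 / r"] s r by simp
      also have "\<dots> \<le> c2 * (2 * real L) * \<phi> (1 / real s)"
      proof (intro mult_right_mono mult_left_mono)
        \<comment> \<open>The base is at least one and the exponent below one.\<close>
        have "(real s / r) powr \<alpha>2 \<le> (real s / r) powr 1" using s r c by (intro powr_mono) auto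
        also have "\<dots> \<le> 2 * real L" using s r by (simp add: divide_le_eq)
        finally show "(real s / r) powr \<alpha>2 \<le> 2 * real L" .
      qed (use c pos in auto)
      finally show ?thesis .
    qed
    have "C * (real n * \<phi> (1 / r) / sqrt r ^ ?d)
        \<le> C * (real n * (c2 * (2 * real L) * \<phi> (1 / real s)) / sqrt r ^ ?d)"
      using phi_r C r by (intro mult_left_mono divide_right_mono) auto
    also have "\<dots> = cT * (real n * \<phi> (1 / real s)) * (cW / (sqrt (8 * real L) * sqrt r) ^ ?d)"
      using c L r by (simp add: C_def field_simps power_mult_distrib)
    also have "\<dots> \<le> cT * (real n * \<phi> (1 / real s)) * (cW / sqrt (4 * real s) ^ ?d)"
    proof -
      have "sqrt (4 * real s) \<le> sqrt (8 * real L) * sqrt r"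
        using s(3) by (simp add: mult_ac flip: real_sqrt_mult)
      thus ?thesis
        using cT cW pos s r L by (intro mult_left_mono divide_left_mono power_mono mult_pos_pos) auto
    qed
    also have "\<dots> = (\<Sum>k\<in>{s<..2 * s}. B * (cW / sqrt (4 * real s) ^ ?d))"
      using s by (simp add: B_def)
    also have "\<dots> \<le> (\<Sum>k\<in>{s<..2 * s}. B * (\<Sum>j\<le>?d. ?w (f (k, j))))"
      using wB B0 by (intro sum_mono mult_left_mono)
    also have "\<dots> \<le> (\<Sum>k\<in>{s<..2 * s}. \<Sum>j\<le>?d. ?t (f (k, j)) * ?w (f (k, j)))"
      unfolding sum_distrib_left using tB by (intro sum_mono mult_right_mono) auto
    also have "\<dots> = (\<Sum>p\<in>?J. ?t (f p) * ?w (f p))"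
      by (simp add: sum.cartesian_product)
    also have "\<dots> = (\<Sum>m\<in>f ` ?J. ?t m * ?w m)"
      by (simp add: sum.reindex[OF inj])
    also have "\<dots> \<le> transition_prob \<mu> n x y"
      by (rule transition_prob_ge_sum) simp
    finally show ?thesis .
  qed
  show ?thesis
  proof (rule that[OF C])
    fix n :: nat and r and x y :: "int ^ 'd"
    assume *: "n \<ge> 1" "r \<ge> 1" "(lattice_norm (y - x))\<^sup>2 \<le> r" "real n * \<phi> (1 / r) \<le> 1"
    show "C * (real n * \<phi> (1 / r) / sqrt r ^ ?d) \<le> transition_prob \<mu> n x y"
      by (rule main[OF *])
  qed
qed

theorem theorem5p1:
  fixes \<phi> :: "real \<Rightarrow> real" and \<mu> :: "real measure"
  assumes "complete_bernstein \<phi> \<mu>"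
    and "\<phi> 0 = 0" and "\<phi> 1 = 1"
    and "scaling_condition \<phi>"
  shows "\<exists>C>0. \<forall>(x :: int ^ 'd::finite) y. \<forall>n\<ge>1.
    ereal (transition_prob \<mu> n x y) \<ge>
      ereal C * min
        (ereal (the_inv_into {0..} \<phi> (1 / real n) powr (real CARD('d) / 2)))
        (if x = y then \<infinity>
         else ereal (real n / lattice_norm (x - y) ^ CARD('d) * \<phi> (1 / (lattice_norm (x - y))\<^sup>2)))"
proof -
  obtain C where C: "C > 0"
    "\<And>n r (x :: int ^ 'd) y. n \<ge> (1::nat) \<Longrightarrow> r \<ge> 1 \<Longrightarrow> (lattice_norm (y - x))\<^sup>2 \<le> r \<Longrightarrow>
      real n * \<phi> (1 / r) \<le> 1 \<Longrightarrow> C * (real n * \<phi> (1 / r) / sqrt r ^ CARD('d)) \<le> transition_prob \<mu> n x y"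
    using transition_prob_scale_lower_bound[OF assms] by metis
  show ?thesis
  proof (intro exI[of _ C] conjI allI impI)
    fix x y :: "int ^ 'd" and n :: nat assume n: "n \<ge> 1"
    define u where "u = the_inv_into {0..} \<phi> (1 / real n)"
    define l where "l = lattice_norm (x - y)"
    have u: "0 < u" "u \<le> 1" "\<phi> u = 1 / real n"
      unfolding u_def using bernstein_inverse[OF assms n] by auto
    have l_commute: "lattice_norm (y - x) = l"
    proof -
      have "(\<chi> i. real_of_int ((y - x) $ i)) = - (\<chi> i. real_of_int ((x - y) $ i))"
        by (simp add: vec_eq_iff)
      thus ?thesis unfolding l_def lattice_norm_def by (metis norm_minus_cancel)
    qed
    have l0: "l \<ge> 0" by (simp add: l_def lattice_norm_def)
    let ?A = "u powr (real CARD('d) / 2)" and ?B = "real n / l ^ CARD('d) * \<phi> (1 / l\<^sup>2)"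
    have "ereal C * min (ereal ?A) (if x = y then \<infinity> else ereal ?B) \<le> ereal (transition_prob \<mu> n x y)"
    proof (cases "l\<^sup>2 \<le> 1 / u")
      case True
      have "C * (real n * \<phi> (1 / (1 / u)) / sqrt (1 / u) ^ CARD('d)) \<le> transition_prob \<mu> n x y"
        using True u n by (intro C(2)) (auto simp: l_commute)
      also have "real n * \<phi> (1 / (1 / u)) / sqrt (1 / u) ^ CARD('d) = ?A"
        using u n by (simp add: real_sqrt_divide power_divide powr_half_sqrt[symmetric] powr_power)
      finally have "ereal C * ereal ?A \<le> ereal (transition_prob \<mu> n x y)" by simp
      moreover have "ereal C * min (ereal ?A) (if x = y then \<infinity> else ereal ?B) \<le> ereal C * ereal ?A"
        using C(1) by (intro ereal_mult_left_mono) auto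
      ultimately show ?thesis by (rule order_trans[rotated])
    next
      case False
      hence ul: "1 / u < l\<^sup>2" "1 \<le> 1 / u" using u by auto
      hence l1: "1 < l\<^sup>2" by linarith
      have "x \<noteq> y"
      proof
        assume "x = y"
        hence "l = 0" by (simp add: l_def lattice_norm_def flip: zero_vec_def)
        thus False using l1 by simp
      qed
      have "1 < u * l\<^sup>2" using ul(1) u by (simp add: field_simps)
      hence "1 / l\<^sup>2 \<le> u" using l1 u by (auto simp: divide_le_eq)
      hence "\<phi> (1 / l\<^sup>2) \<le> \<phi> u"
        using strict_mono_on_leD[OF complete_bernstein_strict_mono[OF assms(1,3)], of "1 / l\<^sup>2" u] u l1
        by auto
      hence "real n * \<phi> (1 / l\<^sup>2) \<le> 1" using u n by (simp add: field_simps)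
      hence "C * (real n * \<phi> (1 / l\<^sup>2) / sqrt (l\<^sup>2) ^ CARD('d)) \<le> transition_prob \<mu> n x y"
        using l1 n by (intro C(2)) (auto simp: l_commute)
      hence "ereal C * ereal ?B \<le> ereal (transition_prob \<mu> n x y)" using l0 by simp
      moreover have "ereal C * min (ereal ?A) (if x = y then \<infinity> else ereal ?B) \<le> ereal C * ereal ?B"
        using C(1) \<open>x \<noteq> y\<close> by (intro ereal_mult_left_mono) auto
      ultimately show ?thesis by (rule order_trans[rotated])
    qed
    thus "ereal C * min (ereal (the_inv_into {0..} \<phi> (1 / real n) powr (real CARD('d) / 2)))
        (if x = y then \<infinity>
         else ereal (real n / lattice_norm (x - y) ^ CARD('d) * \<phi> (1 / (lattice_norm (x - y))\<^sup>2)))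
      \<le> ereal (transition_prob \<mu> n x y)"
      by (simp only: u_def l_def)
  qed (rule C(1))
qed

end
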